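(* Let $(F_n)_{n\in\mathbb{N}}$ be ballistic aggregation in $\mathbb{Z}^2$. Then almost surely the fractal dimension $\delta_f$ of $(F_n)_{n\in\mathbb{N}}$ exists and equals $2$, i.e. almost surely $$\lim_{n\to\infty}\frac{\log(\# F_n)}{\log(\mathrm{rad}(F_n))}=2.$$
   Context: Here $\mathbb{N}=\{1,2,\ldots\}$, $\|\cdot\|$ is the Euclidean norm, $d=2$ throughout. Two points $x,y\in\mathbb{Z}^d$ are neighbours if $\|x-y\|=1$. For a finite $A\subset\mathbb{Z}^d$, the outer boundary is $\partial A=\{y\in\mathbb{Z}^d\setminus A:\ y \text{ has a neighbour in } A\}$, and $\mathrm{rad}(A)=\max_{x\in A}\|x\|$. For a sequence $(A_n)$ of finite sets the lower and upper fractal dimension are $\underline{\delta}_f=\liminf_{n\to\infty}\frac{\log(\#A_n)}{\log(\mathrm{rad}(A_n))}$ and $\overline{\delta}_f=\limsup_{n\to\infty}\frac{\log(\#A_n)}{\log(\mathrm{rad}(A_n))}$; if they coincide, the common value is the fractal dimension $\delta_f$. Incremental aggregation: let $\mathcal{M}=(\mu_A)$ be a family of probability measures indexed by the nonempty finite sets $A\subset\mathbb{Z}^d$, with $\mu_A$ a probability measure on $A$. A sequence $(F_n)_{n\in\mathbb{N}}$ of random finite subsets of $\mathbb{Z}^d$ on a probability space is called incremental aggregation with distribution family $\mathcal{M}$ if $F_1=\{y_1\}$ with $y_1=0$ and, for each $n\in\mathbb{N}$, $F_{n+1}=F_n\cup\{y_{n+1}\}$, where $y_{n+1}$ is a random point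 of $\mathbb{Z}^d$ whose conditional distribution given $F_1,\ldots,F_n$ depends only on $F_n$ and equals $\mu_{\partial F_n}$, i.e. $\mathbb{P}(y_{n+1}=y\mid F_n=A)=\mu_{\partial A}(y)$. In particular $(F_n)$ is a Markov chain. Ballistic measure: let $A(d,1)$ be the space of (affine) lines in $\mathbb{R}^d$ with its usual Borel $\sigma$-algebra; for compact $K\subset\mathbb{R}^d$ let $[K]=\{L\in A(d,1): L\cap K\neq\emptyset\}$. Let $\mu_1$ be the unique Radon measure on $A(d,1)$ invariant under Euclidean motions with $\mu_1([B_d])=\kappa_{d-1}$, where $B_d$ is the closed unit ball of $\mathbb{R}^d$ and $\kappa_{d-1}$ is the volume of the unit ball in $\mathbb{R}^{d-1}$. For compact $K$ with $\mu_1([K])>0$ define the probability measure $\mathbb{P}^K(\cdot)=\mu_1(\cdot\cap[K])/\mu_1([K])$ on $A(d,1)$. For $z\in\mathbb{Z}^d$ let $C_z=z+[-\tfrac12,\tfrac12]^d$ and for finite $A\subset\mathbb{Z}^d$ let $\square A=\bigcup_{z\in A}C_z$. For each line $L$ fix a direction $v_L\in\mathbb{S}^{d-1}$ of $L$ (measurably in $L$). For a nonempty finite $A\subset\mathbb{Z}^d$ let $L^A=\{z\in A: C_z\cap L\neq\emptyset\}$; traversing $L$ in direction $v_L$ orders $L^A$ according to the order in which the boxes $C_z$ are visited (this is well defined for $\mu_1$-almost every $L$; ties for the exceptional lines are broken lexicographically), and $\min(L^A)$, $\max(L^A)$ denote the first and last point of $L^A$ in this order. Set $b_A(z,L)=1$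 if $L^A=\{z\}$; $b_A(z,L)=\tfrac12$ if $\#(L^A)>1$ and $z\in\{\min(L^A),\max(L^A)\}$; and $b_A(z,L)=0$ otherwise. The ballistic measure on $A$ is $b_A(z)=\int_{A(d,1)}b_A(z,L)\,\mathbb{P}^{\square A}(dL)$, $z\in\mathbb{Z}^d$; it is a probability measure concentrated on $A$. Ballistic aggregation in $\mathbb{Z}^d$ is incremental aggregation with distribution family $(b_A)$. *)

theory Defs
  imports "HOL-Probability.Probability"
begin

section \<open>Lattice sets and fractal dimension\<close>

type_synonym lattice = "int ^ 2"

definition point :: "lattice \<Rightarrow> real ^ 2" where
  "point z = (\<chi> i. real_of_int (z $ i))"

definition neighbours :: "lattice \<Rightarrow> lattice \<Rightarrow> bool" where
  "neighbours x y \<longleftrightarrow> norm (point x - point y) = 1"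

definition outer_boundary :: "lattice set \<Rightarrow> lattice set" where
  "outer_boundary A = {y. y \<notin> A \<and> (\<exists>x\<in>A. neighbours y x)}"

definition rad :: "lattice set \<Rightarrow> real" where
  "rad A = Max ((\<lambda>x. norm (point x)) ` A)"

definition lower_fractal_dim :: "(nat \<Rightarrow> lattice set) \<Rightarrow> ereal" where
  "lower_fractal_dim A = liminf (\<lambda>n. ereal (ln (real (card (A n))) / ln (rad (A n))))"

definition upper_fractal_dim :: "(nat \<Rightarrow> lattice set) \<Rightarrow> ereal" where
  "upper_fractal_dim A = limsup (\<lambda>n. ereal (ln (real (card (A n))) / ln (rad (A n))))"

definition has_fractal_dim :: "(nat \<Rightarrow> lattice set) \<Rightarrow> ereal \<Rightarrow> bool" where
  "has_fractal_dim A \<delta> \<longleftrightarrow> lower_fractal_dim A = \<delta> \<and> upper_fractal_dim A = \<delta>"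


section \<open>Incremental aggregation\<close>

text \<open>A distribution family is given by its point masses: \<open>m A z\<close> is the mass that the measure
  indexed by \<open>A\<close> gives to \<open>z\<close>. Sequences start at index 1; \<open>F 0\<close> and \<open>y 0\<close> are irrelevant.
  All random objects take countably many values, so the conditional law given
  \<open>F 1, \<dots>, F n\<close> is given by elementary conditional probabilities on the histories
  of positive probability.\<close>

definition incremental_aggregation ::
  "'w measure \<Rightarrow> (lattice set \<Rightarrow> lattice \<Rightarrow> real) \<Rightarrow> (nat \<Rightarrow> 'w \<Rightarrow> lattice set) \<Rightarrow> bool" where
  "incremental_aggregation M m F \<longleftrightarrow> prob_space M \<and>
     (\<exists>y. (\<forall>n\<ge>1. y n \<in> M \<rightarrow>\<^sub>M count_space UNIV) \<and>
          (\<forall>\<omega>\<in>space M. y 1 \<omega> = 0 \<and> F 1 \<omega> = {y 1 \<omega>}) \<and>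
          (\<forall>n\<ge>1. \<forall>\<omega>\<in>space M. F (n + 1) \<omega> = F n \<omega> \<union> {y (n + 1) \<omega>}) \<and>
          (\<forall>n\<ge>1. \<forall>(A :: nat \<Rightarrow> lattice set) z.
             \<P>(\<omega> in M. \<forall>i\<in>{1..n}. F i \<omega> = A i) > 0 \<longrightarrow>
             \<P>(\<omega> in M. y (n + 1) \<omega> = z \<bar> \<forall>i\<in>{1..n}. F i \<omega> = A i) = m (outer_boundary (A n)) z))"


section \<open>The space of lines in the plane\<close>

definition lines :: "(real ^ 2) set set" where
  "lines = {L. affine L \<and> aff_dim L = 1}"

definition line_through :: "real ^ 2 \<Rightarrow> real ^ 2 \<Rightarrow> (real ^ 2) set" where
  "line_through p v = range (\<lambda>t::real. p + t *\<^sub>R v)"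

lemma line_through_in_lines:
  assumes "norm v = 1"
  shows "line_through p v \<in> lines"
proof -
  have "line_through p v = affine hull {p, p + v}"
    unfolding line_through_def affine_hull_2_alt by auto
  moreover have "p \<noteq> p + v"
    using assms by auto
  ultimately show ?thesis
    by (simp add: lines_def aff_dim_2)
qed

lemma lines_eq: "lines = (\<lambda>(p, v). line_through p v) ` (UNIV \<times> sphere 0 1)"
proof (intro equalityI subsetI)
  fix L assume "L \<in> lines"
  then have L: "affine L" "aff_dim L = 1" by (auto simp: lines_def)
  then obtain B where B: "\<not> affine_dependent B" "affine hull B = L" "int (card B) = aff_dim L + 1"
    using aff_dim_basis_exists[of L] L(1) by (metis affine_hull_eq)
  then have "card B = 2" using L by simp
  then obtain p q where pq: "B = {p, q}" "p \<noteq> q"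
    by (auto simp: card_2_iff)
  define v where "v = (1 / norm (q - p)) *\<^sub>R (q - p)"
  have n: "norm (q - p) \<noteq> 0" using pq by simp
  have "L = range (\<lambda>t. p + t *\<^sub>R (q - p))"
    using B pq by (auto simp: affine_hull_2_alt)
  also have "\<dots> = line_through p v"
  proof -
    have "p + t *\<^sub>R (q - p) = p + (t * norm (q - p)) *\<^sub>R v" for t
      using n by (simp add: v_def)
    moreover have "p + t *\<^sub>R v = p + (t / norm (q - p)) *\<^sub>R (q - p)" for t
      by (simp add: v_def)
    ultimately show ?thesis
      unfolding line_through_def by (intro equalityI image_subsetI) (auto simp only: rangeI)
  qed
  finally have "L = line_through p v" .
  moreover have "norm v = 1" using n by (simp add: v_def)
  ultimately show "L \<in> (\<lambda>(p, v). line_through p v) ` (UNIV \<times> sphere 0 1)"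
    by (intro image_eqI[of _ _ "(p, v)"]) auto
qed (auto simp: line_through_in_lines)

text \<open>The usual topology on \<open>lines\<close>: the quotient topology under
  \<open>(p, v) \<mapsto> p + \<real> v\<close>, for \<open>p\<close> in the plane and \<open>v\<close> a unit vector.\<close>

definition line_topology :: "(real ^ 2) set topology" where
  "line_topology = topology (\<lambda>U. U \<subseteq> lines \<and>
     openin (top_of_set (UNIV \<times> sphere 0 1))
       {x \<in> UNIV \<times> sphere 0 1. line_through (fst x) (snd x) \<in> U})"

lemma openin_line_topology:
  "openin line_topology U \<longleftrightarrow> U \<subseteq> lines \<and>
     openin (top_of_set (UNIV \<times> sphere 0 1))
       {x \<in> UNIV \<times> sphere 0 1. line_through (fst x) (snd x) \<in> U}"
proof -
  let ?X = "top_of_set ((UNIV :: (real^2) set) \<times> sphere (0 :: real^2) 1)"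
  let ?P = "\<lambda>U. {x \<in> UNIV \<times> sphere 0 1. line_through (fst x) (snd x) \<in> U}"
  have "istopology (\<lambda>U. U \<subseteq> lines \<and> openin ?X (?P U))"
    unfolding istopology_def
  proof (intro conjI allI impI)
    fix S T assume S: "S \<subseteq> lines \<and> openin ?X (?P S)" and T: "T \<subseteq> lines \<and> openin ?X (?P T)"
    then show "S \<inter> T \<subseteq> lines" by blast
    have "?P (S \<inter> T) = ?P S \<inter> ?P T" by blast
    moreover have "openin ?X (?P S \<inter> ?P T)" using S T by (blast intro: openin_Int)
    ultimately show "openin ?X (?P (S \<inter> T))" by (simp only:)
  next
    fix K assume K: "\<forall>S\<in>K. S \<subseteq> lines \<and> openin ?X (?P S)"
    then show "\<Union>K \<subseteq> lines" by blast
    have "?P (\<Union>K) = \<Union>(?P ` K)" by blast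
    moreover have "openin ?X (\<Union>(?P ` K))" using K by (intro openin_Union) blast
    ultimately show "openin ?X (?P (\<Union>K))" by (simp only:)
  qed
  then show ?thesis
    unfolding line_topology_def by (simp only: topology_inverse')
qed

lemma topspace_line_topology: "topspace line_topology = lines"
proof -
  have "{x \<in> UNIV \<times> sphere 0 1. line_through (fst x) (snd x) \<in> lines} = UNIV \<times> sphere 0 1"
    by (auto simp: line_through_in_lines)
  then have "openin line_topology lines"
    unfolding openin_line_topology by simp
  moreover have "topspace line_topology \<subseteq> lines"
    by (auto simp: topspace_def openin_line_topology)
  ultimately show ?thesis
    by (simp add: openin_subset subset_antisym)
qed

lemma quotient_map_line_through:
  "quotient_map (top_of_set (UNIV \<times> sphere 0 1)) line_topology
     (\<lambda>x. line_through (fst x) (snd x))"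
  unfolding quotient_map_def topspace_line_topology openin_line_topology lines_eq
  by (simp add: case_prod_unfold)

definition line_borel :: "(real ^ 2) set measure" where
  "line_borel = sigma (topspace line_topology) {U. openin line_topology U}"

definition hitting :: "(real ^ 2) set \<Rightarrow> (real ^ 2) set set" where
  "hitting K = {L \<in> lines. L \<inter> K \<noteq> {}}"


section \<open>The invariant measure on lines\<close>

definition radon_measure_on :: "'a topology \<Rightarrow> 'a measure \<Rightarrow> bool" where
  "radon_measure_on X \<mu> \<longleftrightarrow>
     sets \<mu> = sets (sigma (topspace X) {U. openin X U}) \<and>
     (\<forall>K. compactin X K \<longrightarrow> emeasure \<mu> K < \<infinity>) \<and>
     (\<forall>B\<in>sets \<mu>. emeasure \<mu> B = (SUP K\<in>{K. compactin X K \<and> K \<subseteq> B}. emeasure \<mu> K))"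

text \<open>The normalising constant is the volume of the unit ball of the real line.\<close>

definition invariant_line_measure :: "(real ^ 2) set measure \<Rightarrow> bool" where
  "invariant_line_measure \<mu> \<longleftrightarrow>
     radon_measure_on line_topology \<mu> \<and>
     (\<forall>Q t B. rotation_matrix Q \<longrightarrow> B \<in> sets \<mu> \<longrightarrow>
        emeasure \<mu> ((\<lambda>L. (\<lambda>x. Q *v x + t) ` L) ` B) = emeasure \<mu> B) \<and>
     emeasure \<mu> (hitting (cball 0 1)) = emeasure lborel (cball (0::real) 1)"


section \<open>Ballistic measure\<close>

definition cell :: "lattice \<Rightarrow> (real ^ 2) set" where
  "cell z = cbox (point z - (\<chi> i. 1/2)) (point z + (\<chi> i. 1/2))"

definition cells :: "lattice set \<Rightarrow> (real ^ 2) set" where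
  "cells A = (\<Union>z\<in>A. cell z)"

definition direction_choice :: "((real ^ 2) set \<Rightarrow> real ^ 2) \<Rightarrow> bool" where
  "direction_choice v \<longleftrightarrow> v \<in> line_borel \<rightarrow>\<^sub>M borel \<and>
     (\<forall>L\<in>lines. norm (v L) = 1 \<and> (\<exists>p. L = line_through p (v L)))"

definition hit_points :: "lattice set \<Rightarrow> (real ^ 2) set \<Rightarrow> lattice set" where
  "hit_points A L = {z \<in> A. cell z \<inter> L \<noteq> {}}"

text \<open>The position along \<open>L\<close>, in direction \<open>u\<close>, at which \<open>L\<close> enters the cell of \<open>z\<close>. Cells with
  disjoint interiors are entered at distinct positions unless \<open>L\<close> is parallel to an axis or
  contains a corner of a cell; these exceptional lines are a null set.\<close>

definition entry_time :: "real ^ 2 \<Rightarrow> (real ^ 2) set \<Rightarrow> lattice \<Rightarrow> real" where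
  "entry_time u L z = Inf ((\<lambda>x. x \<bullet> u) ` (cell z \<inter> L))"

definition lex_less :: "lattice \<Rightarrow> lattice \<Rightarrow> bool" where
  "lex_less z w \<longleftrightarrow> z $ 1 < w $ 1 \<or> z $ 1 = w $ 1 \<and> z $ 2 < w $ 2"

definition visited_before :: "real ^ 2 \<Rightarrow> (real ^ 2) set \<Rightarrow> lattice \<Rightarrow> lattice \<Rightarrow> bool" where
  "visited_before u L z w \<longleftrightarrow> entry_time u L z < entry_time u L w \<or>
     entry_time u L z = entry_time u L w \<and> lex_less z w"

definition is_first :: "real ^ 2 \<Rightarrow> lattice set \<Rightarrow> (real ^ 2) set \<Rightarrow> lattice \<Rightarrow> bool" where
  "is_first u A L z \<longleftrightarrow> z \<in> hit_points A L \<and>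
     (\<forall>w\<in>hit_points A L. w \<noteq> z \<longrightarrow> visited_before u L z w)"

definition is_last :: "real ^ 2 \<Rightarrow> lattice set \<Rightarrow> (real ^ 2) set \<Rightarrow> lattice \<Rightarrow> bool" where
  "is_last u A L z \<longleftrightarrow> z \<in> hit_points A L \<and>
     (\<forall>w\<in>hit_points A L. w \<noteq> z \<longrightarrow> visited_before u L w z)"

definition ballistic_weight ::
  "((real ^ 2) set \<Rightarrow> real ^ 2) \<Rightarrow> lattice set \<Rightarrow> lattice \<Rightarrow> (real ^ 2) set \<Rightarrow> real" where
  "ballistic_weight v A z L =
     (if hit_points A L = {z} then 1
      else if card (hit_points A L) > 1 \<and> (is_first (v L) A L z \<or> is_last (v L) A L z) then 1/2
      else 0)"

text \<open>\<open>uniform_measure \<mu> (hitting K)\<close> is \<open>\<mu>\<close> restricted to the lines hitting \<open>K\<close> and normalised.\<close>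

definition ballistic_measure ::
  "(real ^ 2) set measure \<Rightarrow> ((real ^ 2) set \<Rightarrow> real ^ 2) \<Rightarrow> lattice set \<Rightarrow> lattice \<Rightarrow> real" where
  "ballistic_measure \<mu> v A z =
     (\<integral>L. ballistic_weight v A z L \<partial>uniform_measure \<mu> (hitting (cells A)))"

definition ballistic_aggregation ::
  "(real ^ 2) set measure \<Rightarrow> ((real ^ 2) set \<Rightarrow> real ^ 2) \<Rightarrow> 'w measure \<Rightarrow>
     (nat \<Rightarrow> 'w \<Rightarrow> lattice set) \<Rightarrow> bool" where
  "ballistic_aggregation \<mu> v M F \<longleftrightarrow> incremental_aggregation M (ballistic_measure \<mu> v) F"

end

theory Submission
  imports Defs "HOL-Real_Asymp.Real_Asymp"
begin

text \<open>A chain of \<open>8 K\<close> neighbouring points, all of norm at least \<open>8 K\<close>, must be attached one after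
  the other before the cluster gets from radius \<open>8 K\<close> to \<open>16 K\<close> (Kesten's argument). By
  integral geometry, a connected set of diameter \<open>r\<close> is hit by lines of measure at least of order
  \<open>r\<close> while a single cell is hit by a bounded measure of lines, so a given point is attached with
  probability \<open>O(1/K)\<close> per step. A union bound over chains and attachment times shows that
  order \<open>K\<^sup>2\<close> steps do not suffice, except with probability exponentially small in \<open>K\<close>. By
  Borel--Cantelli the radius is eventually \<open>O(\<surd>n)\<close>; it is at least of order \<open>\<surd>n\<close> because
  the cluster has \<open>n\<close> points.\<close>

section \<open>The measure of lines hitting a segment\<close>

text \<open>The invariant measure is available only through its invariance and its value on the
  lines hitting the unit disc. Both hitting estimates come from these two facts: a cell is enclosed
  in a unit disc, which has measure 2; for the lower bound, the lines through the disc are covered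
  by two congruent segments and separated segments are packed into a long one. Every line meeting
  the segment from 0 to a cluster point also meets the cells of the outer boundary, where the mass
  lives. Once the cluster has a point of norm at least 8 K, a boundary point therefore has mass at
  most 2 / K. The time scale \<open>K\<^sup>2 div 6\<close> comes from the union bound: with k = 8 K
  links and N steps there are N choose k sets of attachment times, at most 4^k chains ending at a
  given point, and probability at most (2/K)^k for each. The product is at most (e N / K^2)^(8 K),
  and N \<le> K^2 / 6 together with e \<le> 3 makes the base at most 1/2.\<close>

lemma line_eq_hyperplane:
  assumes "L \<in> lines"
  obtains a b where "a \<noteq> 0" "L = {x. a \<bullet> x = b}"
proof -
  have "aff_dim L = int (DIM(real ^ 2)) - 1" "affine hull L = L"
    using assms by (auto simp: lines_def)
  then show thesis
    using that aff_dim_eq_hyperplane[of L] by fastforce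
qed

lemma line_nonempty:
  assumes "L \<in> lines"
  obtains p where "p \<in> L"
  using assms by (force simp: lines_def)

lemma lines_eqI:
  assumes "L \<in> lines" "N \<in> lines" "{p, q} \<subseteq> L \<inter> N" "p \<noteq> q"
  shows "L = N"
proof -
  have "affine hull {p, q} = K" if "K \<in> lines" "{p, q} \<subseteq> K" for K
  proof -
    have "affine hull K = K" "aff_dim {p, q} = aff_dim K"
      using that assms(4) by (auto simp: lines_def aff_dim_2)
    then show ?thesis using aff_dim_eq_full_gen[of "{p, q}" K] that(2) by simp
  qed
  then show ?thesis using assms by blast
qed

lemma hyperplane_in_lines:
  fixes a :: "real ^ 2"
  assumes "a \<noteq> 0"
  shows "{x. a \<bullet> x = b} \<in> lines"
  using assms by (simp add: lines_def affine_hyperplane)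

lemma affine_segment_point:
  "a \<bullet> ((1 - t) *\<^sub>R x + t *\<^sub>R y) - b = (1 - t) * (a \<bullet> x - b) + t * (a \<bullet> y - b)"
  by (simp add: inner_add_right algebra_simps)

text \<open>Lines in the plane are hyperplanes, so by the intermediate value theorem incidence with
  a segment becomes a sign condition on the affine function
  \<open>a \<bullet> x - b\<close>.\<close>

lemma hyperplane_meets_segment_iff:
  fixes a :: "'a::euclidean_space"
  shows "{x. a \<bullet> x = b} \<inter> closed_segment x y \<noteq> {} \<longleftrightarrow> (a \<bullet> x - b) * (a \<bullet> y - b) \<le> 0"
proof
  assume "{x. a \<bullet> x = b} \<inter> closed_segment x y \<noteq> {}"
  then obtain t where t: "0 \<le> t" "t \<le> 1" "a \<bullet> ((1 - t) *\<^sub>R x + t *\<^sub>R y) = b"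
    by (force simp: in_segment)
  then have z: "(1 - t) * (a \<bullet> x - b) + t * (a \<bullet> y - b) = 0"
    using affine_segment_point[of a t x y b] by simp
  show "(a \<bullet> x - b) * (a \<bullet> y - b) \<le> 0"
  proof (rule ccontr)
    assume "\<not> ?thesis"
    then consider "a \<bullet> x - b > 0" "a \<bullet> y - b > 0" | "a \<bullet> x - b < 0" "a \<bullet> y - b < 0"
      by (auto simp: zero_less_mult_iff not_le)
    then show False
    proof cases
      case 1
      then have "(1 - t) * (a \<bullet> x - b) + t * (a \<bullet> y - b) > 0"
        using t by (cases "t = 0") (auto intro!: add_nonneg_pos)
      then show False using z by simp
    next
      case 2
      then have "(1 - t) * (b - a \<bullet> x) + t * (b - a \<bullet> y) > 0"
        using t by (cases "t = 0") (auto intro!: add_nonneg_pos)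
      then show False using z by (simp add: algebra_simps)
    qed
  qed
next
  assume le: "(a \<bullet> x - b) * (a \<bullet> y - b) \<le> 0"
  have "connected (closed_segment x y)" by simp
  moreover have "min (a \<bullet> x) (a \<bullet> y) \<le> b" "b \<le> max (a \<bullet> x) (a \<bullet> y)"
    using le by (auto simp: mult_le_0_iff min_def max_def)
  ultimately obtain z where "z \<in> closed_segment x y" "a \<bullet> z = b"
    using connected_ivt_hyperplane[of "closed_segment x y" x y a b]
      connected_ivt_hyperplane[of "closed_segment x y" y x a b]
    by (auto simp: min_def max_def split: if_splits)
  then show "{x. a \<bullet> x = b} \<inter> closed_segment x y \<noteq> {}" by auto
qed

text \<open>Pasch's axiom: if the affine function defining the line does not have one strict sign at
  both \<open>x\<close> and \<open>z\<close>, its sign at \<open>y\<close> cannot strictly agree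
  with both.\<close>

lemma line_meets_triangle_side:
  assumes "L \<in> lines" "L \<inter> closed_segment x z \<noteq> {}"
  shows "L \<inter> closed_segment x y \<noteq> {} \<or> L \<inter> closed_segment y z \<noteq> {}"
proof -
  obtain a b where "L = {x. a \<bullet> x = b}"
    using line_eq_hyperplane[OF assms(1)] by metis
  then show ?thesis
    using assms(2) by (simp only: hyperplane_meets_segment_iff) (auto simp: mult_le_0_iff)
qed

section \<open>Hitting sets: topology and rigid motions\<close>

lemma hitting_mono: "K \<subseteq> K' \<Longrightarrow> hitting K \<subseteq> hitting K'"
  by (auto simp: hitting_def)

text \<open>Eliminates the parameter along the line: incidence becomes an equation continuous in
  \<open>k\<close>, \<open>p\<close> and \<open>v\<close> jointly, hence a closed relation.\<close>

lemma in_line_through_iff: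
  assumes "norm v = 1"
  shows "k \<in> line_through p v \<longleftrightarrow> k - p = ((k - p) \<bullet> v) *\<^sub>R v"
proof -
  have "v \<bullet> v = 1" using assms by (simp add: norm_eq_1)
  then show ?thesis
    unfolding line_through_def
    by (auto simp: algebra_simps intro!: rev_image_eqI[of "(k - p) \<bullet> v"])
qed

text \<open>This makes hitting sets of compact sets Borel. The pairs (p, v) whose line meets
  \<open>K\<close> form the projection of a closed relation along the compact factor
  \<open>K\<close>, which is closed.\<close>

lemma openin_lines_minus_hitting:
  assumes "compact K"
  shows "openin line_topology (lines - hitting K)"
proof -
  let ?T = "{(k, p, v). k - p = ((k - p) \<bullet> v) *\<^sub>R v} :: ((real^2) \<times> (real^2) \<times> (real^2)) set"
  have "closed ?T"
    unfolding case_prod_unfold by (intro closed_Collect_eq continuous_intros)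
  then have cl: "closed {y. \<exists>k. k \<in> K \<and> (k, y) \<in> ?T}"
    by (rule closed_compact_projection[OF assms])
  have "{x \<in> UNIV \<times> sphere 0 1. line_through (fst x) (snd x) \<in> lines - hitting K} =
        (UNIV \<times> sphere 0 1) \<inter> - {y. \<exists>k. k \<in> K \<and> (k, y) \<in> ?T}"
    by (auto simp: hitting_def line_through_in_lines in_line_through_iff disjoint_iff)
  then show ?thesis
    unfolding openin_line_topology using cl by (auto simp: openin_open_Int open_Compl)
qed

text \<open>Transfers invariance of the measure from sets of lines to targets. One inclusion moves
  lines by the motion, the other pulls them back by its inverse, so the auxiliary fact
  \<open>ln\<close> is stated for an arbitrary orthogonal matrix.\<close>

lemma hitting_image:
  fixes Q :: "real^2^2"
  assumes "rotation_matrix Q"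
  shows "(\<lambda>L. (\<lambda>x. Q *v x + t) ` L) ` hitting K = hitting ((\<lambda>x. Q *v x + t) ` K)"
proof -
  let ?g = "\<lambda>x. Q *v x + t"
  have Q: "orthogonal_matrix Q" using assms by (simp add: rotation_matrix_def)
  define R where "R = transpose Q"
  have R: "orthogonal_matrix R" using Q by (simp add: R_def orthogonal_matrix_transpose)
  have "R ** Q = mat 1" "Q ** R = mat 1"
    using Q by (simp_all add: orthogonal_matrix_def R_def)
  then have tr: "R *v (Q *v x) = x" "Q *v (R *v x) = x" for x
    by (simp_all add: matrix_vector_mul_assoc)
  have inj: "inj ?g"
    by (rule injI) (metis add_right_cancel tr(1))
  have ln: "(\<lambda>x. R *v x + s) ` L \<in> lines" if "L \<in> lines" "orthogonal_matrix R" for L s and R :: "real^2^2"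
  proof -
    obtain p v where L: "L = line_through p v" "norm v = 1"
      using \<open>L \<in> lines\<close> by (auto simp: lines_eq)
    have "(\<lambda>x. R *v x + s) ` L = line_through (R *v p + s) (R *v v)"
      unfolding L line_through_def image_image
      by (simp add: matrix_vector_right_distrib matrix_vector_mult_scaleR algebra_simps)
    moreover have "norm (R *v v) = 1"
      using L(2) that(2) orthogonal_transformation_norm[of "(*v) R"]
      by (simp add: orthogonal_transformation_matrix)
    ultimately show ?thesis by (simp add: line_through_in_lines)
  qed
  have gR: "?g ` ((\<lambda>x. R *v x + - (R *v t)) ` L) = L" for L
    by (simp add: image_image tr matrix_vector_mult_diff_distrib)
  show ?thesis
  proof (intro equalityI subsetI)
    fix L assume "L \<in> (\<lambda>L. ?g ` L) ` hitting K"
    then show "L \<in> hitting (?g ` K)"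
      using ln[OF _ Q] by (auto simp: hitting_def)
  next
    fix L assume L: "L \<in> hitting (?g ` K)"
    define L' where "L' = (\<lambda>x. R *v x + - (R *v t)) ` L"
    have gL: "?g ` L' = L" unfolding L'_def by (rule gR)
    have "L' \<in> lines"
      unfolding L'_def using L R by (intro ln) (auto simp: hitting_def)
    moreover have "L' \<inter> K \<noteq> {}"
    proof -
      have "?g ` L' \<inter> ?g ` K \<noteq> {}" using L gL by (auto simp: hitting_def)
      then show ?thesis using inj by (metis image_Int image_is_empty)
    qed
    ultimately have "L' \<in> hitting K" by (simp add: hitting_def)
    then show "L \<in> (\<lambda>L. ?g ` L) ` hitting K" using gL by blast
  qed
qed

lemma rotation_matrix_mat_1: "rotation_matrix (mat 1 :: real^'n^'n)"
  by (simp add: rotation_matrix_def orthogonal_matrix_id)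

section \<open>Consequences of invariance and normalisation\<close>

locale invariant_lines =
  fixes \<mu> :: "(real ^ 2) set measure"
  assumes invariant: "invariant_line_measure \<mu>"
begin

lemma sets_eq: "sets \<mu> = sets (sigma lines {U. openin line_topology U})"
  using invariant by (simp add: invariant_line_measure_def radon_measure_on_def topspace_line_topology)

lemma lines_sigma: "{U. openin line_topology U} \<subseteq> Pow lines"
  using openin_subset topspace_line_topology by fastforce

lemma space_eq: "space \<mu> = lines"
  using sets_eq_imp_space_eq[OF sets_eq] lines_sigma by (simp add: space_measure_of)

lemma hitting_sets [measurable]:
  assumes "compact K"
  shows "hitting K \<in> sets \<mu>"
proof -
  have "lines - hitting K \<in> sets \<mu>"
    unfolding sets_eq using openin_lines_minus_hitting[OF assms] lines_sigma
    by (simp add: sets_measure_of)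
  then have "space \<mu> - (lines - hitting K) \<in> sets \<mu>"
    by (rule sets.compl_sets)
  moreover have "space \<mu> - (lines - hitting K) = hitting K"
    by (auto simp: space_eq hitting_def)
  ultimately show ?thesis by simp
qed

lemma emeasure_motion:
  assumes "rotation_matrix Q" "B \<in> sets \<mu>"
  shows "emeasure \<mu> ((\<lambda>L. (\<lambda>x. Q *v x + t) ` L) ` B) = emeasure \<mu> B"
  using invariant assms by (simp add: invariant_line_measure_def)

lemma emeasure_hitting_motion:
  assumes "rotation_matrix Q" "compact K"
  shows "emeasure \<mu> (hitting ((\<lambda>x. Q *v x + t) ` K)) = emeasure \<mu> (hitting K)"
  using emeasure_motion[OF assms(1) hitting_sets[OF assms(2)]] hitting_image[OF assms(1)] by metis

lemma emeasure_hitting_ball: "emeasure \<mu> (hitting (cball p 1)) = 2"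
proof -
  have "emeasure \<mu> (hitting ((\<lambda>x. mat 1 *v x + p) ` cball 0 1)) = emeasure \<mu> (hitting (cball 0 1))"
    by (rule emeasure_hitting_motion[OF rotation_matrix_mat_1]) simp
  also have "\<dots> = emeasure lborel (cball (0::real) 1)"
    using invariant by (simp add: invariant_line_measure_def)
  also have "\<dots> = 2"
    by (simp add: cball_eq_atLeastAtMost)
  also have "(\<lambda>x. mat 1 *v x + p) ` cball 0 1 = cball p 1"
    using cball_translation[of p 0 1] by (simp add: add.commute)
  finally show ?thesis .
qed

text \<open>For every n, the translates of \<open>L\<close> by i/n along its unit normal, i < n, are
  n distinct lines of equal mass that all hit the unit disc around a point of \<open>L\<close>.
  Hence n times that mass is at most 2.\<close>

lemma emeasure_line_eq_0:
  assumes "L \<in> lines"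
  shows "emeasure \<mu> {L} = 0" and "{L} \<in> sets \<mu>"
proof -
  obtain a b where a: "a \<noteq> 0" and L: "L = {x. a \<bullet> x = b}"
    using line_eq_hyperplane[OF assms] by metis
  obtain p where p: "p \<in> L" using line_nonempty[OF assms] .
  \<comment> \<open>Two points determine a line, so its singleton is the intersection of two hitting
    sets of points.\<close>
  have sing: "{L} \<in> sets \<mu>" if "L \<in> lines" for L
  proof -
    obtain p v where L: "L = line_through p v" "norm v = 1"
      using \<open>L \<in> lines\<close> by (auto simp: lines_eq)
    have pv: "p \<in> L" "p + v \<in> L" "p \<noteq> p + v"
      using L unfolding line_through_def
      by (auto intro: range_eqI[of _ _ "0::real"] range_eqI[of _ _ "1::real"])
    have "N = L" if "N \<in> hitting {p} \<inter> hitting {p + v}" for N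
      using that pv \<open>L \<in> lines\<close> by (intro lines_eqI[of N L p "p + v"]) (auto simp: hitting_def)
    moreover have "L \<in> hitting {p} \<inter> hitting {p + v}"
      using pv(1,2) \<open>L \<in> lines\<close> by (simp add: hitting_def)
    ultimately have "{L} = hitting {p} \<inter> hitting {p + v}" by blast
    then show ?thesis by simp
  qed
  then show "{L} \<in> sets \<mu>" using assms .
  define u where "u = (1 / norm a) *\<^sub>R a"
  have au: "a \<bullet> u = norm a" using a
    by (simp add: u_def power2_norm_eq_inner[symmetric] power2_eq_square)
  have nu: "norm u = 1" using a by (simp add: u_def)
  define T where "T s = (\<lambda>x. mat 1 *v x + s *\<^sub>R u) ` L" for s :: real
  have Teq: "T s = {x. a \<bullet> x = b + s * norm a}" for s
  proof (intro equalityI subsetI)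
    fix x assume "x \<in> T s" then show "x \<in> {x. a \<bullet> x = b + s * norm a}"
      by (auto simp: T_def L inner_add_right au)
  next
    fix x assume "x \<in> {x. a \<bullet> x = b + s * norm a}"
    then have "x - s *\<^sub>R u \<in> L" by (simp add: L inner_diff_right au)
    then have "mat 1 *v (x - s *\<^sub>R u) + s *\<^sub>R u \<in> T s" unfolding T_def by blast
    then show "x \<in> T s" by simp
  qed
  have Tl: "T s \<in> lines" for s unfolding Teq by (rule hyperplane_in_lines[OF a])
  have ps: "p + s *\<^sub>R u \<in> T s" for s using p by (simp add: Teq L inner_add_right au)
  have injT: "s = t" if "T s = T t" for s t
  proof -
    have "p + s *\<^sub>R u \<in> T t" using ps[of s] that by simp
    then show ?thesis using p a by (simp add: Teq L inner_add_right au)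
  qed
  have eT: "emeasure \<mu> {T s} = emeasure \<mu> {L}" for s
    using emeasure_motion[OF rotation_matrix_mat_1 sing[OF assms], of "s *\<^sub>R u"] by (simp add: T_def)
  have bound: "of_nat n * emeasure \<mu> {L} \<le> 2" for n
  proof -
    have disj: "disjoint_family_on (\<lambda>i. {T (real i / real n)}) {..<n}"
      by (auto simp: disjoint_family_on_def dest!: injT)
    have "of_nat n * emeasure \<mu> {L} = (\<Sum>i<n. emeasure \<mu> {T (real i / real n)})"
      by (simp add: eT)
    also have "\<dots> = emeasure \<mu> (\<Union>i<n. {T (real i / real n)})"
      using disj by (intro sum_emeasure) (auto intro: sing Tl)
    also have "\<dots> \<le> emeasure \<mu> (hitting (cball p 1))"
    proof (rule emeasure_mono)
      show "(\<Union>i<n. {T (real i / real n)}) \<subseteq> hitting (cball p 1)"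
      proof clarify
        fix i assume "i < n"
        then have "p + (real i / real n) *\<^sub>R u \<in> cball p 1"
          using nu by (simp add: dist_norm)
        then show "T (real i / real n) \<in> hitting (cball p 1)"
          using ps Tl by (fastforce simp: hitting_def)
      qed
    qed simp
    finally show ?thesis by (simp add: emeasure_hitting_ball)
  qed
  show "emeasure \<mu> {L} = 0"
  proof (cases "emeasure \<mu> {L}")
    case (real r)
    have "real n * r \<le> 2" for n
      using bound[of n] real by (simp add: ennreal_of_nat_eq_real_of_nat ennreal_mult[symmetric]
          ennreal_le_iff2 flip: ennreal_numeral)
    then have "\<not> r > 0"
      using reals_Archimedean3[of r] by (metis not_le)
    then show ?thesis using real by simp
  next
    case top
    then show ?thesis using bound[of 1] by (simp add: top_unique)
  qed
qed

text \<open>The two arms of the cross spanned by \<open>\<plusminus>2 e\<^sub>1\<close> and \<open>\<plusminus>2 e\<^sub>2\<close> together catch every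
  line that meets the unit ball.\<close>

lemma emeasure_hitting_segment_ge_1:
  assumes w: "norm w = 1"
  shows "emeasure \<mu> (hitting (closed_segment p (p + 4 *\<^sub>R w))) \<ge> 1"
proof -
  define e :: "2 \<Rightarrow> real^2" where "e i = axis i 1" for i
  have card2: "2 \<le> CARD(2)" by simp
  define S where "S u = closed_segment (- 2 *\<^sub>R u) (2 *\<^sub>R u)" for u :: "real^2"
  have comp: "compact (S u)" for u by (simp add: S_def)
  have same: "emeasure \<mu> (hitting ((+) t ` S u)) = emeasure \<mu> (hitting (S (e 1)))"
    if u: "norm u = 1" for t u
  proof -
    obtain Q :: "real^2^2" where Q: "rotation_matrix Q" "Q *v e 1 = u"
      using rotation_matrix_exists_basis[OF card2, of u "1 :: 2"] u unfolding e_def by metis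
    have "(\<lambda>x. Q *v x + t) ` S (e 1) = (+) t ` ((*v) Q ` S (e 1))"
      by (auto simp: image_image add.commute)
    also have "(*v) Q ` S (e 1) = S u"
      unfolding S_def using closed_segment_linear_image[of "(*v) Q" "- 2 *\<^sub>R e 1" "2 *\<^sub>R e 1"] Q
      by (simp add: matrix_vector_mult_scaleR matrix_vector_mul_linear linear_neg)
    finally show ?thesis
      using emeasure_hitting_motion[OF Q(1) comp, of t "e 1"] by simp
  qed
  have cover: "hitting (cball 0 1) \<subseteq> hitting (S (e 1)) \<union> hitting (S (e 2))"
  proof
    fix L assume H: "L \<in> hitting (cball 0 1)"
    then obtain a b where a: "a \<noteq> 0" and L: "L = {x. a \<bullet> x = b}"
      using line_eq_hyperplane unfolding hitting_def by blast
    obtain x where x: "norm x \<le> 1" "a \<bullet> x = b"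
      using H unfolding L hitting_def by (auto simp: disjoint_iff)
    have "\<bar>b\<bar> \<le> norm a * norm x" using Cauchy_Schwarz_ineq2[of a x] x by simp
    also have "\<dots> \<le> norm a" using x(1) by (simp add: mult_left_le)
    also have "\<dots> \<le> \<bar>a $ 1\<bar> + \<bar>a $ 2\<bar>" using norm_le_l1_cart[of a] by (simp add: sum_2)
    \<comment> \<open>The larger coordinate of \<open>a\<close> carries at least half of the sum.
      This is why the arms end at \<plusminus>2 e_i, where the linear form \<open>a\<close> takes
      the values \<plusminus>2 a_i.\<close>
    finally have "\<bar>b\<bar> \<le> 2 * \<bar>a $ 1\<bar> \<or> \<bar>b\<bar> \<le> 2 * \<bar>a $ 2\<bar>" by linarith
    moreover have "L \<in> hitting (S (e i))" if "\<bar>b\<bar> \<le> 2 * \<bar>a $ i\<bar>" for i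
    proof -
      have "(a \<bullet> (- 2 *\<^sub>R e i) - b) * (a \<bullet> (2 *\<^sub>R e i) - b) = b\<^sup>2 - (2 * a $ i)\<^sup>2"
        by (simp add: e_def inner_axis power2_eq_square algebra_simps)
      also have "\<dots> \<le> 0" using abs_le_square_iff[of b "2 * a $ i"] that by (simp add: abs_mult)
      finally have "L \<inter> S (e i) \<noteq> {}"
        unfolding L S_def hyperplane_meets_segment_iff .
      then show ?thesis using H by (simp add: hitting_def)
    qed
    ultimately show "L \<in> hitting (S (e 1)) \<union> hitting (S (e 2))" by blast
  qed
  let ?m = "emeasure \<mu> (hitting (S (e 1)))"
  have "2 = emeasure \<mu> (hitting (cball 0 1))" by (simp add: emeasure_hitting_ball)
  also have "\<dots> \<le> emeasure \<mu> (hitting (S (e 1)) \<union> hitting (S (e 2)))"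
    using cover comp by (intro emeasure_mono) auto
  also have "\<dots> \<le> ?m + emeasure \<mu> (hitting (S (e 2)))"
    using comp by (intro emeasure_subadditive) auto
  also have "emeasure \<mu> (hitting (S (e 2))) = ?m"
    using same[of "e 2" 0] by (simp add: e_def)
  finally have "2 * 1 \<le> 2 * ?m" by (simp add: mult_2)
  then have "1 \<le> ?m" by (subst (asm) ennreal_mult_le_mult_iff) auto
  also have "?m = emeasure \<mu> (hitting ((+) (p + 2 *\<^sub>R w) ` S w))" using same[OF w] by simp
  also have "(+) (p + 2 *\<^sub>R w) ` S w = closed_segment p (p + 4 *\<^sub>R w)"
    unfolding S_def closed_segment_translation[symmetric]
    by (simp flip: scaleR_add_left add: add.assoc)
  finally show ?thesis .
qed

text \<open>Pieces of length 4 separated by gaps are hit by disjoint sets of lines, up to the line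
  containing all of them.\<close>

lemma emeasure_hitting_segment_ge:
  assumes "8 * real K \<le> norm x"
  shows "emeasure \<mu> (hitting (closed_segment 0 x)) \<ge> of_nat K"
proof (cases "x = 0")
  case False
  define w where "w = (1 / norm x) *\<^sub>R x"
  have w: "norm w = 1" and xw: "x = norm x *\<^sub>R w" using False by (auto simp: w_def)
  \<comment> \<open>Period 8 = piece of length 4 plus gap of length 4: distinct pieces share no
    point, and \<open>K\<close> pieces fit into length 8 K. This is the origin of the factor 8 in
    the hypothesis.\<close>
  define p where "p i = (8 * real i) *\<^sub>R w" for i
  define I where "I i = closed_segment (p i) (p i + 4 *\<^sub>R w)" for i
  let ?L = "line_through 0 w"
  have Ll: "?L \<in> lines" using w by (rule line_through_in_lines)
  have Ipt: "\<exists>s. y = s *\<^sub>R w \<and> 8 * real i \<le> s \<and> s \<le> 8 * real i + 4" if "y \<in> I i" for y i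
  proof -
    obtain t where "0 \<le> t" "t \<le> 1" "y = (1 - t) *\<^sub>R p i + t *\<^sub>R (p i + 4 *\<^sub>R w)"
      using \<open>y \<in> I i\<close> by (auto simp: I_def in_segment)
    then have "y = (8 * real i + 4 * t) *\<^sub>R w" "0 \<le> t" "t \<le> 1"
      by (auto simp: p_def algebra_simps)
    then show ?thesis by (intro exI[of _ "8 * real i + 4 * t"]) auto
  qed
  let ?H = "\<lambda>i. hitting (I i) - {?L}"
  have comp: "compact (I i)" for i by (simp add: I_def)
  have Hs: "?H i \<in> sets \<mu>" for i
    using comp emeasure_line_eq_0(2)[OF Ll] by auto
  have disj: "disjoint_family_on ?H {..<K}"
    unfolding disjoint_family_on_def
  proof (intro ballI impI)
    fix i j assume ij: "i \<in> {..<K}" "j \<in> {..<K}" "i \<noteq> j"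
    show "?H i \<inter> ?H j = {}"
    proof (rule ccontr)
      assume "?H i \<inter> ?H j \<noteq> {}"
      then obtain N y z where N: "N \<in> lines" "N \<noteq> ?L" "y \<in> N" "y \<in> I i" "z \<in> N" "z \<in> I j"
        by (auto simp: hitting_def)
      obtain s t where st: "y = s *\<^sub>R w" "8 * real i \<le> s" "s \<le> 8 * real i + 4"
          "z = t *\<^sub>R w" "8 * real j \<le> t" "t \<le> 8 * real j + 4"
        using Ipt N(4,6) by metis
      have "real i + 1 \<le> real j \<or> real j + 1 \<le> real i" using ij(3) by linarith
      then have "s \<noteq> t" using st by linarith
      then have "N = ?L"
        using N st w Ll by (intro lines_eqI[of N ?L y z]) (auto simp: line_through_def)
      then show False using N(2) by simp
    qed
  qed
  have e: "emeasure \<mu> (?H i) \<ge> 1" for i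
  proof -
    have "1 \<le> emeasure \<mu> (hitting (I i))"
      unfolding I_def using w by (rule emeasure_hitting_segment_ge_1)
    also have "\<dots> \<le> emeasure \<mu> (?H i \<union> {?L})"
      using Hs[of i] emeasure_line_eq_0(2)[OF Ll] by (intro emeasure_mono sets.Un) auto
    also have "\<dots> \<le> emeasure \<mu> (?H i) + emeasure \<mu> {?L}"
      using Hs emeasure_line_eq_0(2)[OF Ll] by (intro emeasure_subadditive) auto
    finally show ?thesis by (simp add: emeasure_line_eq_0(1)[OF Ll])
  qed
  have "of_nat K = (\<Sum>i<K. 1::ennreal)" by simp
  also have "\<dots> \<le> (\<Sum>i<K. emeasure \<mu> (?H i))" by (intro sum_mono e)
  also have "\<dots> = emeasure \<mu> (\<Union>i<K. ?H i)"
    using disj Hs by (intro sum_emeasure) auto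
  also have "\<dots> \<le> emeasure \<mu> (hitting (closed_segment 0 x))"
  proof (rule emeasure_mono)
    have "I i \<subseteq> closed_segment 0 x" if "i < K" for i
    proof
      fix y assume "y \<in> I i"
      then obtain s where s: "y = s *\<^sub>R w" "8 * real i \<le> s" "s \<le> 8 * real i + 4"
        using Ipt by metis
      have "real i + 1 \<le> real K" using that by linarith
      then have "0 \<le> s" "s \<le> norm x" using s assms by linarith+
      moreover have "y = (s / norm x) *\<^sub>R x" using s(1) xw False
        by (simp add: w_def)
      ultimately show "y \<in> closed_segment 0 x"
        using False unfolding in_segment by (intro exI[of _ "s / norm x"]) simp
    qed
    then show "(\<Union>i<K. ?H i) \<subseteq> hitting (closed_segment 0 x)"
      by (auto simp: hitting_def)
  qed simp
  finally show ?thesis .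
qed (use assms in simp)

end

section \<open>Clusters and the ballistic measure\<close>

lemma in_cell_iff: "x \<in> cell z \<longleftrightarrow> (\<forall>i. \<bar>x $ i - real_of_int (z $ i)\<bar> \<le> 1/2)"
proof -
  have "\<bar>a - b\<bar> \<le> 1/2 \<longleftrightarrow> b - 1/2 \<le> a \<and> a \<le> b + 1/2" for a b :: real
    by linarith
  then show ?thesis unfolding cell_def mem_box_cart by (simp add: point_def)
qed

lemma compact_cells: "finite A \<Longrightarrow> compact (cells A)"
  by (auto simp: cells_def cell_def intro!: compact_UN)

lemma point_in_cell: "point z \<in> cell z"
  by (simp add: in_cell_iff point_def)

lemma convex_cell: "convex (cell z)"
  by (simp add: cell_def)

lemma cell_subset_cball: "cell z \<subseteq> cball (point z) 1"
proof
  fix x assume "x \<in> cell z"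
  then have "\<bar>x $ 1 - point z $ 1\<bar> \<le> 1/2" "\<bar>x $ 2 - point z $ 2\<bar> \<le> 1/2"
    by (auto simp: in_cell_iff point_def)
  then have "norm (x - point z) \<le> 1"
    using norm_le_l1_cart[of "x - point z"] by (simp add: sum_2)
  then show "x \<in> cball (point z) 1" by (simp add: dist_norm norm_minus_commute)
qed

lemma neighbours_iff: "neighbours x y \<longleftrightarrow> \<bar>x $ 1 - y $ 1\<bar> + \<bar>x $ 2 - y $ 2\<bar> = 1"
proof -
  let ?a = "x $ 1 - y $ 1" and ?b = "x $ 2 - y $ 2"
  have "neighbours x y \<longleftrightarrow> (norm (point x - point y))\<^sup>2 = 1"
    by (simp add: neighbours_def power2_eq_1_iff) (smt (verit) norm_ge_zero)
  also have "(norm (point x - point y))\<^sup>2 = real_of_int (?a\<^sup>2 + ?b\<^sup>2)"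
    unfolding power2_norm_eq_inner by (simp add: inner_vec_def sum_2 point_def power2_eq_square)
  also have "\<dots> = 1 \<longleftrightarrow> ?a\<^sup>2 + ?b\<^sup>2 = 1" by linarith
  also have "\<dots> \<longleftrightarrow> \<bar>?a\<bar> + \<bar>?b\<bar> = 1"
  proof
    assume 1: "?a\<^sup>2 + ?b\<^sup>2 = 1"
    then have "?a\<^sup>2 \<le> 1" "?b\<^sup>2 \<le> 1" by (smt (verit) zero_le_power2)+
    then have "\<bar>?a\<bar> \<le> 1" "\<bar>?b\<bar> \<le> 1" by (simp_all add: abs_square_le_1)
    then have "?a \<in> {-1, 0, 1}" "?b \<in> {-1, 0, 1}" by auto
    then show "\<bar>?a\<bar> + \<bar>?b\<bar> = 1" using 1 by auto
  next
    assume 1: "\<bar>?a\<bar> + \<bar>?b\<bar> = 1"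
    then have "(?a = 1 \<or> ?a = -1) \<and> ?b = 0 \<or> ?a = 0 \<and> (?b = 1 \<or> ?b = -1)" by linarith
    then show "?a\<^sup>2 + ?b\<^sup>2 = 1" by (elim conjE disjE) (simp_all only:, simp_all)
  qed
  finally show ?thesis .
qed

lemma neighbours_sym: "neighbours x y \<longleftrightarrow> neighbours y x"
  by (simp add: neighbours_def norm_minus_commute)

definition nbhd :: "lattice \<Rightarrow> lattice set" where
  "nbhd z = {z + axis 1 1, z - axis 1 1, z + axis 2 1, z - axis 2 1}"

lemma in_nbhd_iff: "u \<in> nbhd z \<longleftrightarrow> neighbours u z"
  by (auto simp: nbhd_def neighbours_iff vec_eq_iff forall_2 axis_def)

lemma finite_nbhd: "finite (nbhd z)" and card_nbhd_le: "card (nbhd z) \<le> 4"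
  by (simp_all add: nbhd_def card_insert_if)

lemma finite_outer_boundary: "finite A \<Longrightarrow> finite (outer_boundary A)"
  by (rule finite_subset[of _ "\<Union>(nbhd ` A)"])
    (auto simp: outer_boundary_def in_nbhd_iff finite_nbhd)

text \<open>The last point at which the line leaves the cells of \<open>A\<close> lies in a cell of \<open>A\<close> and in a
  cell entered immediately afterwards, which is not one of \<open>A\<close>. If those two cells only share
  a corner, that corner also belongs to the cell of a common neighbour.\<close>

lemma hitting_cells_subset_boundary:
  assumes "finite A"
  shows "hitting (cells A) \<subseteq> hitting (cells (outer_boundary A))"
proof
  fix L assume H: "L \<in> hitting (cells A)"
  then have "L \<in> lines" by (simp add: hitting_def)
  then obtain p v where L: "L = line_through p v" "norm v = 1"
    by (auto simp: lines_eq)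
  define T where "T = {t. p + t *\<^sub>R v \<in> cells A}"
  have "compact T"
  proof (rule compact_eq_bounded_closed[THEN iffD2], intro conjI)
    show "closed T"
      unfolding T_def using compact_imp_closed[OF compact_cells[OF assms]]
      by (intro closed_vimage[unfolded vimage_def]) (auto intro!: continuous_intros)
    obtain b where b: "\<And>x. x \<in> cells A \<Longrightarrow> norm x \<le> b"
      using compact_imp_bounded[OF compact_cells[OF assms]] by (auto simp: bounded_iff)
    show "bounded T"
    proof (rule boundedI)
      fix t assume "t \<in> T"
      then have "norm (p + t *\<^sub>R v) \<le> b" using b by (simp add: T_def)
      then show "norm t \<le> b + norm p"
        using norm_triangle_ineq4[of "p + t *\<^sub>R v" p] L(2) by simp
    qed
  qed
  moreover have "T \<noteq> {}"
    using H by (auto simp: hitting_def T_def L line_through_def)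
  ultimately obtain t where t: "t \<in> T" and tmax: "\<And>s. s \<in> T \<Longrightarrow> s \<le> t"
    using compact_attains_sup by metis
  define q where "q = p + t *\<^sub>R v"
  have qL: "q \<in> L" by (auto simp: q_def L line_through_def)
  obtain z where z: "z \<in> A" "q \<in> cell z"
    using t by (auto simp: T_def q_def cells_def)
  \<comment> \<open>The cell just ahead of \<open>q\<close>: when \<open>q\<close> lies on a face
    between cells, floor or ceiling is chosen by the sign of the velocity. The room
    \<open>s i\<close> left in coordinate \<open>i\<close> is then strictly positive, and since the
    speed in each coordinate is at most 1 the ray stays in \<open>cell w\<close> up to time
    \<open>min (s 1) (s 2)\<close>.\<close>
  define w :: lattice where
    "w = (\<chi> i. if v $ i \<ge> 0 then \<lfloor>q $ i + 1/2\<rfloor> else \<lceil>q $ i - 1/2\<rceil>)"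
  define s where "s i = (if v $ i \<ge> 0 then w $ i + 1/2 - q $ i else q $ i - w $ i + 1/2)" for i
  have s: "s i > 0" for i
    unfolding s_def w_def by (auto; linarith)
  have qw: "q \<in> cell w"
    unfolding in_cell_iff
  proof
    fix i
    have "\<bar>x - real_of_int \<lfloor>x + 1/2\<rfloor>\<bar> \<le> 1/2" "\<bar>x - real_of_int \<lceil>x - 1/2\<rceil>\<bar> \<le> 1/2" for x :: real
      by linarith+
    then show "\<bar>q $ i - real_of_int (w $ i)\<bar> \<le> 1/2"
      by (auto simp: w_def)
  qed
  define r where "r = min (s 1) (s 2)"
  have r: "r > 0" "r \<le> s i" for i
    using s exhaust_2[of i] by (auto simp: r_def)
  have "q + r *\<^sub>R v \<in> cell w"
    unfolding in_cell_iff
  proof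
    fix i
    have "\<bar>v $ i\<bar> \<le> 1" using component_le_norm_cart[of v i] L(2) by simp
    then have "r * \<bar>v $ i\<bar> \<le> r * 1" using r(1) by (intro mult_left_mono) auto
    then have "r * \<bar>v $ i\<bar> \<le> s i" using r(2)[of i] by linarith
    moreover have "r * \<bar>v $ i\<bar> \<ge> 0" using r(1) by simp
    moreover have "\<bar>q $ i - w $ i\<bar> \<le> 1/2" using qw by (simp only: in_cell_iff)
    moreover have "s i = (if v $ i \<ge> 0 then w $ i + 1/2 - q $ i else q $ i - w $ i + 1/2)"
      by (rule s_def)
    moreover have "r * \<bar>v $ i\<bar> = (if v $ i \<ge> 0 then r * v $ i else - (r * v $ i))" by simp
    ultimately have "\<bar>q $ i + r * v $ i - real_of_int (w $ i)\<bar> \<le> 1/2"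
      by (simp only: split: if_splits)
    then show "\<bar>(q + r *\<^sub>R v) $ i - real_of_int (w $ i)\<bar> \<le> 1/2" by simp
  qed
  moreover have "t + r \<notin> T" using tmax[of "t + r"] r(1) by fastforce
  ultimately have wA: "w \<notin> A"
    by (auto simp: T_def cells_def q_def algebra_simps)
  have near: "\<bar>w $ i - z $ i\<bar> \<le> 1" for i
  proof -
    have "\<bar>q $ i - w $ i\<bar> \<le> 1/2" "\<bar>q $ i - z $ i\<bar> \<le> 1/2"
      using qw z(2) by (auto simp: in_cell_iff)
    then show ?thesis by linarith
  qed
  have "w \<noteq> z" using wA z(1) by blast
  then have ne: "w $ 1 \<noteq> z $ 1 \<or> w $ 2 \<noteq> z $ 2" by (auto simp: vec_eq_iff forall_2)
  have "\<exists>x\<in>outer_boundary A. q \<in> cell x"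
  proof (cases "w $ 1 = z $ 1 \<or> w $ 2 = z $ 2")
    case True
    then have "neighbours w z" using near[of 1] near[of 2] ne by (auto simp: neighbours_iff)
    then show ?thesis using wA z(1) qw by (auto simp: outer_boundary_def)
  next
    case False
    \<comment> \<open>A diagonal step from \<open>z\<close> to \<open>w\<close>. If \<open>u\<close>
      lies in \<open>A\<close>, then \<open>w\<close> is a boundary point next to \<open>u\<close>;
      otherwise \<open>u\<close> is one next to \<open>z\<close>. Either cell contains
      \<open>q\<close>.\<close>
    define u :: lattice where "u = vector [z $ 1, w $ 2]"
    have u: "u $ 1 = z $ 1" "u $ 2 = w $ 2" by (simp_all add: u_def)
    have qu: "q \<in> cell u" using qw z(2) by (simp add: in_cell_iff forall_2 u)
    have "neighbours w u" "neighbours u z"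
      using False near[of 1] near[of 2] by (auto simp: neighbours_iff u)
    then show ?thesis using wA z(1) qw qu
      by (cases "u \<in> A") (auto simp: outer_boundary_def)
  qed
  then show "L \<in> hitting (cells (outer_boundary A))"
    using qL \<open>L \<in> lines\<close> by (auto simp: hitting_def cells_def)
qed

section \<open>Connected clusters\<close>

inductive cluster :: "lattice set \<Rightarrow> bool" where
  origin: "cluster {0}"
| attach: "cluster A \<Longrightarrow> z \<in> outer_boundary A \<Longrightarrow> cluster (insert z A)"

lemma cluster_finite: "cluster A \<Longrightarrow> finite A"
  by (induction rule: cluster.induct) auto

text \<open>The midpoint lies on the common face, and each half of the segment stays in one convex
  cell.\<close>

lemma closed_segment_neighbours_subset:
  assumes "neighbours u z"
  shows "closed_segment (point u) (point z) \<subseteq> cell u \<union> cell z"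
proof -
  have nb: "\<bar>u $ 1 - z $ 1\<bar> + \<bar>u $ 2 - z $ 2\<bar> = 1" using assms by (simp add: neighbours_iff)
  define m where "m = midpoint (point u) (point z)"
  have "\<bar>real_of_int (u $ i) - real_of_int (z $ i)\<bar> \<le> 1" for i
  proof -
    have "\<bar>u $ i - z $ i\<bar> \<le> 1" using nb exhaust_2[of i] by auto
    then show ?thesis by linarith
  qed
  moreover have "m $ i = (real_of_int (u $ i) + real_of_int (z $ i)) / 2" for i
    by (simp add: m_def midpoint_def point_def)
  moreover have "\<bar>(a + b) / 2 - a\<bar> \<le> 1/2 \<and> \<bar>(a + b) / 2 - b\<bar> \<le> 1/2" if "\<bar>a - b\<bar> \<le> 1" for a b :: real
    using that by (auto simp: abs_le_iff field_simps)
  ultimately have "\<bar>m $ i - real_of_int (u $ i)\<bar> \<le> 1/2 \<and> \<bar>m $ i - real_of_int (z $ i)\<bar> \<le> 1/2" for i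
    by metis
  then have "m \<in> cell u" "m \<in> cell z" by (auto simp: in_cell_iff)
  then have "closed_segment (point u) m \<subseteq> cell u" "closed_segment m (point z) \<subseteq> cell z"
    by (simp_all add: closed_segment_subset convex_cell point_in_cell)
  moreover have "closed_segment (point u) (point z) = closed_segment (point u) m \<union> closed_segment m (point z)"
    unfolding m_def by (rule Un_closed_segment[symmetric]) simp
  ultimately show ?thesis by blast
qed

text \<open>Connectedness enters as induction on the last attached point \<open>z\<close>, with a
  neighbour \<open>u\<close> already present. In the triangle 0, u, z, a line crossing the side from
  0 to z crosses the side from 0 to u, covered by induction, or the short side from u to z, covered
  by two cells.\<close>

lemma cluster_hitting_segment:
  assumes "cluster A" "x \<in> A"
  shows "hitting (closed_segment 0 (point x)) \<subseteq> hitting (cells A)"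
  using assms
proof (induction arbitrary: x rule: cluster.induct)
  case origin
  have "point 0 = 0" by (simp add: point_def vec_eq_iff)
  then show ?case using origin point_in_cell[of 0] by (auto simp: hitting_def cells_def)
next
  case (attach A z)
  have mono: "hitting (cells A) \<subseteq> hitting (cells (insert z A))"
    by (rule hitting_mono) (auto simp: cells_def)
  show ?case
  proof (cases "x \<in> A")
    case True
    then show ?thesis using attach.IH mono by blast
  next
    case False
    then have x: "x = z" using attach.prems by simp
    obtain u where u: "u \<in> A" "neighbours u z"
      using attach.hyps(2) neighbours_sym by (auto simp: outer_boundary_def)
    show ?thesis
    proof
      fix L assume "L \<in> hitting (closed_segment 0 (point x))"
      then have L: "L \<in> lines" "L \<inter> closed_segment 0 (point z) \<noteq> {}"
        by (auto simp: hitting_def x)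
      from line_meets_triangle_side[OF this, of "point u"]
      show "L \<in> hitting (cells (insert z A))"
      proof
        assume "L \<inter> closed_segment 0 (point u) \<noteq> {}"
        then show ?thesis using L(1) attach.IH[OF u(1)] mono by (auto simp: hitting_def)
      next
        assume "L \<inter> closed_segment (point u) (point z) \<noteq> {}"
        then show ?thesis
          using closed_segment_neighbours_subset[OF u(2)] u(1) L(1)
          unfolding hitting_def cells_def by blast
      qed
    qed
  qed
qed

section \<open>Upper bound for the mass of a boundary point\<close>

lemma ballistic_weight_le: "L \<in> lines \<Longrightarrow> ballistic_weight v A z L \<le> indicator (hitting (cell z)) L"
  by (auto simp: ballistic_weight_def indicator_def hitting_def is_first_def is_last_def hit_points_def
      Int_commute)

lemma ballistic_measure_eq_0: "z \<notin> A \<Longrightarrow> ballistic_measure \<mu> v A z = 0"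
proof -
  assume "z \<notin> A"
  then have "ballistic_weight v A z L = 0" for L
    by (auto simp: ballistic_weight_def is_first_def is_last_def hit_points_def)
  then show ?thesis by (simp add: ballistic_measure_def)
qed

context invariant_lines
begin

lemma emeasure_hitting_cell_le: "emeasure \<mu> (hitting (cell z)) \<le> 2"
proof -
  have "emeasure \<mu> (hitting (cell z)) \<le> emeasure \<mu> (hitting (cball (point z) 1))"
    by (intro emeasure_mono hitting_mono cell_subset_cball hitting_sets) simp
  then show ?thesis by (simp add: emeasure_hitting_ball)
qed

lemma hitting_cells_finite:
  assumes "finite A"
  shows "emeasure \<mu> (hitting (cells A)) < \<infinity>"
proof -
  have "hitting (cells A) = (\<Union>z\<in>A. hitting (cell z))"
    by (auto simp: hitting_def cells_def)
  then have "emeasure \<mu> (hitting (cells A)) \<le> (\<Sum>z\<in>A. emeasure \<mu> (hitting (cell z)))"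
    using assms by (auto intro!: emeasure_subadditive_finite hitting_sets simp: cell_def)
  also have "\<dots> < \<infinity>"
    using assms le_less_trans[OF emeasure_hitting_cell_le ennreal_numeral_less_top] by auto
  finally show ?thesis .
qed

text \<open>The mass is at most a ratio of hitting measures: that of \<open>cell z\<close>, at most
  2, over that of the boundary cells, at least that of the segment from 0 to \<open>x\<close> and so
  at least \<open>K\<close>.\<close>

lemma ballistic_measure_boundary_le:
  assumes A: "cluster A" and x: "x \<in> A" and K: "8 * real K \<le> norm (point x)" "K > 0"
  shows "ballistic_measure \<mu> v (outer_boundary A) z \<le> 2 / real K"
proof -
  let ?H = "hitting (cells (outer_boundary A))" and ?C = "hitting (cell z)"
  have fin: "finite (outer_boundary A)" using cluster_finite[OF A] by (rule finite_outer_boundary)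
  have Hs: "?H \<in> sets \<mu>" using compact_cells[OF fin] by (rule hitting_sets)
  have Cs: "?C \<in> sets \<mu>" by (intro hitting_sets) (simp add: cell_def)
  have Hfin: "emeasure \<mu> ?H \<noteq> \<infinity>" using hitting_cells_finite[OF fin] by simp
  have "of_nat K \<le> emeasure \<mu> (hitting (closed_segment 0 (point x)))"
    by (rule emeasure_hitting_segment_ge[OF K(1)])
  also have "\<dots> \<le> emeasure \<mu> ?H"
    using cluster_hitting_segment[OF A x] hitting_cells_subset_boundary[OF cluster_finite[OF A]] Hs
    by (intro emeasure_mono) auto
  finally have HK: "of_nat K \<le> emeasure \<mu> ?H" .
  then have H0: "emeasure \<mu> ?H \<noteq> 0" using K(2) by auto
  have mH: "real K \<le> measure \<mu> ?H"
    using HK Hfin unfolding measure_def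
    by (metis enn2real_mono enn2real_of_nat infinity_ennreal_def less_top)
  let ?U = "uniform_measure \<mu> ?H"
  interpret U: prob_space ?U using H0 Hfin by (rule prob_space_uniform_measure)
  \<comment> \<open>Only the dominating indicator has to be shown integrable: a weight that is not
    integrable has integral 0 by convention, and the inequality still holds.\<close>
  have "ballistic_measure \<mu> v (outer_boundary A) z \<le> (\<integral>L. indicator ?C L \<partial>?U)"
    unfolding ballistic_measure_def
  proof (rule integral_mono')
    show "integrable ?U (indicator ?C :: _ \<Rightarrow> real)"
      using Cs by (intro integrable_real_indicator) (auto simp: less_top[symmetric])
    show "ballistic_weight v (outer_boundary A) z L \<le> indicator ?C L" if "L \<in> space ?U" for L
      using that by (intro ballistic_weight_le) (simp add: space_eq)
  qed simp
  also have "\<dots> = measure ?U ?C" using Cs sets.sets_into_space[OF Cs] by (simp add: Int_absorb1)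
  also have "\<dots> = measure \<mu> (?H \<inter> ?C) / measure \<mu> ?H"
    using H0 Hfin Cs by (simp add: measure_uniform_measure)
  also have "measure \<mu> (?H \<inter> ?C) \<le> 2"
  proof -
    have "emeasure \<mu> (?H \<inter> ?C) \<le> 2"
      using emeasure_mono[of "?H \<inter> ?C" ?C \<mu>] Cs emeasure_hitting_cell_le[of z] by (meson inf_le2 order_trans)
    then show ?thesis unfolding measure_def
      by (metis enn2real_mono enn2real_numeral ennreal_numeral_less_top)
  qed
  also have "2 / measure \<mu> ?H \<le> 2 / real K"
    using mH K(2) by (intro divide_left_mono) auto
  finally show ?thesis by (simp add: divide_right_mono)
qed

end

section \<open>Cardinality and radius\<close>

text \<open>A single term of the exponential series. With x = n = k it gives k^k / k! \<le> e^k, the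
  weak form of Stirling's formula used next.\<close>

lemma power_div_fact_le_exp:
  fixes x :: real
  assumes "0 \<le> x"
  shows "x ^ n / fact n \<le> exp x"
proof -
  have s: "(\<lambda>n. x ^ n / fact n) sums exp x"
    using exp_converges[of x] by (simp add: field_simps)
  show ?thesis
    using sum_le_suminf[OF sums_summable[OF s], of "{n}"] assms sums_unique[OF s] by simp
qed

lemma binomial_mult_power_le:
  fixes x :: real
  assumes "0 \<le> x" "0 < k"
  shows "real (n choose k) * x ^ k \<le> (exp 1 * real n * x / real k) ^ k"
proof -
  have "real (n choose k) * fact k \<le> real n ^ k"
    using binomial_fact_pow[of n k] by (metis of_nat_fact of_nat_le_iff of_nat_mult of_nat_power)
  then have "real (n choose k) \<le> real n ^ k / fact k"
    by (simp add: field_simps)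
  also have "\<dots> = (real k ^ k / fact k) * (real n / real k) ^ k"
    using assms by (simp add: power_divide)
  also have "\<dots> \<le> exp (real k) * (real n / real k) ^ k"
    using power_div_fact_le_exp[of "real k" k] by (intro mult_right_mono) auto
  also have "exp (real k) = exp 1 ^ k" by (simp flip: exp_of_nat_mult)
  finally have "real (n choose k) * x ^ k \<le> exp 1 ^ k * (real n / real k) ^ k * x ^ k"
    using assms by (intro mult_right_mono) auto
  then show ?thesis by (simp add: power_mult_distrib power_divide)
qed

text \<open>Serves two counts: the points of a cluster of given radius, and the possible end points
  of a chain.\<close>

definition box_around_0 :: "nat \<Rightarrow> lattice set" where
  "box_around_0 N = {z. \<forall>i. \<bar>z $ i\<bar> \<le> int N}"

lemma finite_box_around_0: "finite (box_around_0 N)"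
  and card_box_around_0_le: "card (box_around_0 N) \<le> (2 * N + 1)\<^sup>2"
proof -
  let ?S = "{- int N..int N} \<times> {- int N..int N}"
  have sub: "box_around_0 N \<subseteq> (\<lambda>(a, b). vector [a, b]) ` ?S"
  proof
    fix z assume z: "z \<in> box_around_0 N"
    have "\<bar>z $ 1\<bar> \<le> int N" "\<bar>z $ 2\<bar> \<le> int N" using z by (auto simp: box_around_0_def)
    moreover have "z = vector [z $ 1, z $ 2]" by (simp add: vec_eq_iff forall_2)
    ultimately show "z \<in> (\<lambda>(a, b). vector [a, b]) ` ?S"
      by (intro image_eqI[of _ _ "(z $ 1, z $ 2)"]) auto
  qed
  show "finite (box_around_0 N)" by (rule finite_subset[OF sub]) simp
  have "card (box_around_0 N) \<le> card ?S"
    by (rule surj_card_le[OF _ sub]) simp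
  also have "\<dots> = (2 * N + 1)\<^sup>2"
    by (simp add: card_cartesian_product power2_eq_square nat_add_distrib nat_mult_distrib)
  finally show "card (box_around_0 N) \<le> (2 * N + 1)\<^sup>2" .
qed

lemma norm_point_le_imp_in_box:
  assumes "norm (point z) < real N + 1"
  shows "z \<in> box_around_0 N"
  unfolding box_around_0_def
proof clarify
  fix i
  have "\<bar>real_of_int (z $ i)\<bar> \<le> norm (point z)"
    using component_le_norm_cart[of "point z" i] by (simp add: point_def)
  then show "\<bar>z $ i\<bar> \<le> int N" using assms by linarith
qed

lemma norm_point_neighbours: "neighbours u z \<Longrightarrow> norm (point z) \<le> norm (point u) + 1"
  using norm_triangle_ineq3[of "point u" "point z"] by (simp add: neighbours_def)

lemma point_0: "point 0 = 0"
  by (simp add: point_def vec_eq_iff)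

lemma norm_le_rad: "finite A \<Longrightarrow> x \<in> A \<Longrightarrow> norm (point x) \<le> rad A"
  by (simp add: rad_def)

lemma sqrt_card_le_rad:
  assumes "finite A" "A \<noteq> {}"
  shows "(sqrt (real (card A)) - 1) / 2 \<le> rad A"
proof -
  have "rad A \<ge> 0"
    using assms norm_le_rad[OF assms(1)] by (meson all_not_in_conv norm_ge_zero order_trans)
  define N where "N = nat \<lfloor>rad A\<rfloor>"
  have N: "rad A < real N + 1" "real N \<le> rad A" using \<open>rad A \<ge> 0\<close> by (auto simp: N_def)
  have "A \<subseteq> box_around_0 N"
    using norm_le_rad[OF assms(1)] N(1) by (meson le_less_trans norm_point_le_imp_in_box subsetI)
  then have "card A \<le> (2 * N + 1)\<^sup>2"
    using card_mono[OF finite_box_around_0] card_box_around_0_le order_trans by blast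
  then have "real (card A) \<le> real ((2 * N + 1)\<^sup>2)"
    by (rule of_nat_mono)
  then have "real (card A) \<le> (2 * real N + 1)\<^sup>2"
    by (simp add: add.commute)
  then have "sqrt (real (card A)) \<le> 2 * real N + 1"
    by (simp add: real_le_lsqrt)
  then show ?thesis using N(2) by simp
qed

lemma rad_less:
  assumes "finite A" "A \<noteq> {}" "\<And>x. x \<in> A \<Longrightarrow> norm (point x) < r"
  shows "rad A < r"
  using assms by (simp add: rad_def)

text \<open>The deterministic conclusion. A radius between two multiples of the square root of n, up
  to additive constants, has logarithm asymptotic to (ln n) / 2, so the constants disappear in the
  limit.\<close>

lemma fractal_dim_eq_2:
  fixes A :: "nat \<Rightarrow> lattice set"
  assumes card: "\<And>n. n \<ge> 1 \<Longrightarrow> card (A n) = n"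
    and inc: "\<And>n. n \<ge> 1 \<Longrightarrow> A n \<subseteq> A (n + 1)"
    and growth: "eventually (\<lambda>K. \<forall>z\<in>A (K\<^sup>2 div 6). norm (point z) < 16 * real K) sequentially"
  shows "(\<lambda>n. ln (real (card (A n))) / ln (rad (A n))) \<longlonglongrightarrow> 2"
proof -
  have fin: "finite (A n)" "A n \<noteq> {}" if "n \<ge> 1" for n
    using card[OF that] that by (auto intro: card_ge_0_finite)
  have mono: "A n \<subseteq> A n'" if "1 \<le> n" "n \<le> n'" for n n'
    using that(2)
  proof (induction n' rule: dec_induct)
    case (step k)
    then show ?case using inc[of k] that(1) by auto
  qed simp
  obtain K0 where K0: "\<And>K z. K \<ge> K0 \<Longrightarrow> z \<in> A (K\<^sup>2 div 6) \<Longrightarrow> norm (point z) < 16 * real K"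
    using growth unfolding eventually_sequentially by blast
  have upper: "rad (A n) < 16 * (sqrt (6 * real n) + 1)" if n: "n \<ge> 1" "n \<ge> K0\<^sup>2" for n
  proof -
    \<comment> \<open>The least \<open>K\<close> with 6 n \<le> K^2: time \<open>n\<close> is then
      not after \<open>K\<^sup>2 div 6\<close>, and monotonicity carries the bound known at that
      time back to \<open>n\<close>.\<close>
    define K where "K = nat \<lceil>sqrt (6 * real n)\<rceil>"
    have K: "sqrt (6 * real n) \<le> real K" "real K < sqrt (6 * real n) + 1"
      by (auto simp: K_def; linarith)+
    have "6 * real n \<le> (real K)\<^sup>2"
      using K(1) by (simp add: sqrt_le_D)
    then have "6 * n \<le> K\<^sup>2" by (metis of_nat_le_iff of_nat_mult of_nat_numeral of_nat_power)
    then have "n \<le> K\<^sup>2 div 6" by simp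
    have "real K0 ^ 2 \<le> real n" using n(2) by (metis of_nat_le_iff of_nat_power)
    then have "real K0 \<le> sqrt (real n)" by (simp add: real_le_rsqrt)
    also have "\<dots> \<le> sqrt (6 * real n)" by simp
    finally have "K \<ge> K0" using K(1) by linarith
    then have "norm (point z) < 16 * real K" if "z \<in> A n" for z
      using K0 mono[OF n(1) \<open>n \<le> K\<^sup>2 div 6\<close>] that by blast
    then have "rad (A n) < 16 * real K"
      using fin[OF n(1)] by (intro rad_less)
    also have "\<dots> < 16 * (sqrt (6 * real n) + 1)" using K(2) by simp
    finally show ?thesis .
  qed
  have lower: "(sqrt (real n) - 1) / 2 \<le> rad (A n)" if "n \<ge> 1" for n
    using sqrt_card_le_rad[OF fin[OF that]] card[OF that] by simp
  show ?thesis
  proof (rule tendsto_sandwich)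
    show "(\<lambda>n::nat. ln (real n) / ln (16 * (sqrt (6 * real n) + 1))) \<longlonglongrightarrow> 2" by real_asymp
    show "(\<lambda>n::nat. ln (real n) / ln ((sqrt (real n) - 1) / 2)) \<longlonglongrightarrow> 2" by real_asymp
    \<comment> \<open>From n = 16 on the lower bound for the radius exceeds 1, so the logarithms in
      the denominators are positive.\<close>
    have ev: "eventually (\<lambda>n. n \<ge> 16 \<and> n \<ge> K0\<^sup>2) sequentially"
      by (intro eventually_conj eventually_ge_at_top)
    have big: "(sqrt (real n) - 1) / 2 > 1" if "n \<ge> 16" for n :: nat
    proof -
      have "4 \<le> sqrt (real n)" using that by (intro real_le_rsqrt) simp
      then show ?thesis by simp
    qed
    show "eventually (\<lambda>n. ln (real n) / ln (16 * (sqrt (6 * real n) + 1)) \<le>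
        ln (real (card (A n))) / ln (rad (A n))) sequentially"
      using ev
    proof eventually_elim
      case (elim n)
      then have n: "n \<ge> 1" "n \<ge> K0\<^sup>2" by auto
      have "rad (A n) > 1" using lower[OF n(1)] big[of n] elim by linarith
      then have "0 < ln (rad (A n))" "ln (rad (A n)) \<le> ln (16 * (sqrt (6 * real n) + 1))"
        using upper[OF n] by auto
      then show ?case
        using n(1) card[OF n(1)] by (auto intro!: divide_left_mono)
    qed
    show "eventually (\<lambda>n. ln (real (card (A n))) / ln (rad (A n)) \<le>
        ln (real n) / ln ((sqrt (real n) - 1) / 2)) sequentially"
      using ev
    proof eventually_elim
      case (elim n)
      then have n: "n \<ge> 1" by auto
      have "0 < ln ((sqrt (real n) - 1) / 2)" "ln ((sqrt (real n) - 1) / 2) \<le> ln (rad (A n))"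
        using lower[OF n] big[of n] elim by auto
      then show ?case
        using n card[OF n] by (auto intro!: divide_left_mono)
    qed
  qed
qed

lemma has_fractal_dimI:
  assumes "(\<lambda>n. ln (real (card (A n))) / ln (rad (A n))) \<longlonglongrightarrow> d"
  shows "has_fractal_dim A (ereal d)"
  using lim_imp_Liminf[OF _ tendsto_ereal[OF assms]] lim_imp_Limsup[OF _ tendsto_ereal[OF assms]]
  by (simp add: has_fractal_dim_def lower_fractal_dim_def upper_fractal_dim_def)

section \<open>Chains of attached points\<close>

text \<open>\<open>reach h s k n z\<close>: in the growth history \<open>h\<close> up to time \<open>n\<close>, the point \<open>z\<close> ends a chain of
  \<open>k\<close> neighbouring points attached one after the other, starting from a point of norm at
  least \<open>s\<close>.\<close>

fun reach :: "(nat \<Rightarrow> lattice set) \<Rightarrow> real \<Rightarrow> nat \<Rightarrow> nat \<Rightarrow> lattice \<Rightarrow> bool" where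
  "reach h s 0 n z \<longleftrightarrow> n \<ge> 1 \<and> z \<in> h n \<and> s \<le> norm (point z)"
| "reach h s (Suc k) 0 z \<longleftrightarrow> False"
| "reach h s (Suc k) (Suc n) z \<longleftrightarrow> reach h s (Suc k) n z \<or>
     (n \<ge> 1 \<and> z \<in> h (Suc n) - h n \<and> (\<exists>u\<in>nbhd z. reach h s k n u))"

text \<open>Index 0 is never consulted, owing to the guards \<open>n \<ge> 1\<close> in
  \<open>reach\<close>. The event is thus a function of the recorded history, which makes it
  measurable and fit for conditioning.\<close>

lemma reach_cong:
  assumes "\<And>i. i \<in> {1..n} \<Longrightarrow> h i = h' i"
  shows "reach h s k n z \<longleftrightarrow> reach h' s k n z"
  using assms
proof (induction h s k n z rule: reach.induct)
  case (3 h s k n z)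
  have *: "h i = h' i" if "i \<in> {1..n}" for i using 3(3) that by simp
  show ?case
    using 3(1)[OF *] 3(2)[OF _ *] 3(3)[of n] 3(3)[of "Suc n"] by (cases "n \<ge> 1") auto
qed auto

text \<open>The start of the chain remains in the growing cluster. It is the far point that the mass
  bound requires at each further attachment.\<close>

lemma reach_imp_far:
  assumes "reach h s k n z" "\<And>i. 1 \<le> i \<Longrightarrow> h i \<subseteq> h (i + 1)"
  shows "\<exists>x\<in>h n. s \<le> norm (point x)"
  using assms
proof (induction h s k n z rule: reach.induct)
  case (3 h s k n z)
  have n: "n \<ge> 1"
    using 3(3) by (cases n) auto
  have "\<exists>x\<in>h n. s \<le> norm (point x)"
    using 3 by (auto simp del: One_nat_def)
  then show ?case using 3(4)[OF n] by auto
qed auto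

text \<open>Trace \<open>z\<close> back to the neighbour it was attached to, and so on. Each step
  back lowers the norm by at most 1, so \<open>k\<close> steps are possible without falling below
  \<open>s\<close>. Since \<open>s > 0\<close>, the origin cannot satisfy the norm condition, which
  settles the base case.\<close>

lemma reach_if_growing:
  assumes "n \<ge> 1" "h 1 = {0}"
    and "\<And>i. 1 \<le> i \<Longrightarrow> \<exists>y\<in>outer_boundary (h i). h (i + 1) = insert y (h i)"
    and "z \<in> h n" "s + real k \<le> norm (point z)" "s > 0"
  shows "reach h s k n z"
  using assms(1,4,5)
proof (induction n arbitrary: k z rule: nat_induct_at_least)
  case base
  then show ?case using assms(2,6) by (simp add: point_0)
next
  case (Suc n)
  obtain y where y: "y \<in> outer_boundary (h n)" "h (Suc n) = insert y (h n)"
    using assms(3)[OF Suc.hyps] by auto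
  show ?case
  proof (cases k)
    case 0
    then show ?thesis using Suc.prems by simp
  next
    case [simp]: (Suc j)
    show ?thesis
    proof (cases "z \<in> h n")
      case True
      then show ?thesis using Suc.IH[of z k] Suc.prems by simp
    next
      case False
      then have z: "z = y" using Suc.prems(1) y(2) by simp
      then obtain u where u: "u \<in> h n" "neighbours z u" using y(1) by (auto simp: outer_boundary_def)
      have "norm (point z) \<le> norm (point u) + 1"
        using norm_point_neighbours u(2) neighbours_sym by blast
      then have "reach h s j n u" using Suc.IH[of u j] u(1) Suc.prems(2) by simp
      moreover have "u \<in> nbhd z" using u(2) neighbours_sym by (simp add: in_nbhd_iff)
      ultimately show ?thesis using False Suc.prems(1) Suc.hyps by auto
    qed
  qed
qed

section \<open>Growth histories and their conditional laws\<close>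

text \<open>Abstracts from the ballistic measure: what enters is that \<open>m A\<close> is
  concentrated on \<open>A\<close> and, as a hypothesis of later lemmas, a uniform bound on boundary
  masses.\<close>

locale aggregation = prob_space M for M :: "'w measure" +
  fixes m :: "lattice set \<Rightarrow> lattice \<Rightarrow> real"
    and F :: "nat \<Rightarrow> 'w \<Rightarrow> lattice set" and y :: "nat \<Rightarrow> 'w \<Rightarrow> lattice"
  assumes y_measurable: "\<And>n. n \<ge> 1 \<Longrightarrow> y n \<in> M \<rightarrow>\<^sub>M count_space UNIV"
    and F_1: "\<And>\<omega>. \<omega> \<in> space M \<Longrightarrow> F 1 \<omega> = {0}"
    and F_step: "\<And>n \<omega>. n \<ge> 1 \<Longrightarrow> \<omega> \<in> space M \<Longrightarrow> F (n + 1) \<omega> = insert (y (n + 1) \<omega>) (F n \<omega>)"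
    and conditional_law: "\<And>n A z. n \<ge> 1 \<Longrightarrow>
      \<P>(\<omega> in M. \<forall>i\<in>{1..n}. F i \<omega> = A i) > 0 \<Longrightarrow>
      \<P>(\<omega> in M. y (n + 1) \<omega> = z \<bar> \<forall>i\<in>{1..n}. F i \<omega> = A i) = m (outer_boundary (A n)) z"
    and concentrated: "\<And>A z. z \<notin> A \<Longrightarrow> m A z = 0"
begin

text \<open>There are only countably many finite sets of lattice points. With these as codomain,
  measurability of the next set can be checked with \<open>F n\<close> fixed.\<close>

lemma F_measurable:
  assumes "n \<ge> 1"
  shows "F n \<in> M \<rightarrow>\<^sub>M count_space {A. finite A}"
  using assms
proof (induction n rule: nat_induct_at_least)
  case base
  have "F 1 \<in> M \<rightarrow>\<^sub>M count_space {A. finite A} \<longleftrightarrow> (\<lambda>_. {0 :: lattice}) \<in> M \<rightarrow>\<^sub>M count_space {A. finite A}"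
    by (rule measurable_cong) (rule F_1)
  then show ?case by simp
next
  case (Suc n)
  have "(\<lambda>\<omega>. insert (y (Suc n) \<omega>) (F n \<omega>)) \<in> M \<rightarrow>\<^sub>M count_space {A. finite A}"
  proof (rule measurable_compose_countable'[OF _ Suc.IH])
    fix B :: "lattice set" assume "B \<in> {A. finite A}"
    then have "(\<lambda>z. insert z B) \<in> count_space UNIV \<rightarrow>\<^sub>M count_space {A. finite A}" by simp
    then show "(\<lambda>\<omega>. insert (y (Suc n) \<omega>) B) \<in> M \<rightarrow>\<^sub>M count_space {A. finite A}"
      by (rule measurable_compose[OF y_measurable, rotated]) simp
  qed (rule countable_Collect_finite)
  also have "?this \<longleftrightarrow> F (Suc n) \<in> M \<rightarrow>\<^sub>M count_space {A. finite A}"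
    using F_step[OF Suc.hyps] by (intro measurable_cong) simp
  finally show ?case .
qed

lemma finite_F: "n \<ge> 1 \<Longrightarrow> \<omega> \<in> space M \<Longrightarrow> finite (F n \<omega>)"
  using measurable_space[OF F_measurable] by fastforce

text \<open>\<open>restrict\<close> makes histories extensional, so they form a countable set and
  the event \<open>hist n \<omega> = h\<close> is the conditioning event of the aggregation
  law.\<close>

definition hist :: "nat \<Rightarrow> 'w \<Rightarrow> nat \<Rightarrow> lattice set" where
  "hist n \<omega> = restrict (\<lambda>i. F i \<omega>) {1..n}"

abbreviation histories :: "nat \<Rightarrow> (nat \<Rightarrow> lattice set) set" where
  "histories n \<equiv> PiE {1..n} (\<lambda>_. {A. finite A})"

lemma countable_histories: "countable (histories n)"
  by (intro countable_PiE) (auto intro: countable_Collect_finite)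

lemma hist_eq_iff:
  assumes "h \<in> histories n"
  shows "hist n \<omega> = h \<longleftrightarrow> (\<forall>i\<in>{1..n}. F i \<omega> = h i)"
  using assms by (auto simp: hist_def restrict_def PiE_def extensional_def fun_eq_iff)

lemma hist_measurable: "hist n \<in> M \<rightarrow>\<^sub>M count_space (histories n)"
proof (subst measurable_count_space_eq_countable[OF countable_histories], intro conjI ballI)
  show "hist n \<in> space M \<rightarrow> histories n"
    by (auto simp: hist_def intro!: finite_F)
  fix h assume h: "h \<in> histories n"
  have "{\<omega> \<in> space M. \<forall>i\<in>{1..n}. F i \<omega> = h i} \<in> sets M"
  proof (rule sets.sets_Collect_finite_All)
    fix i assume i: "i \<in> {1..n}"
    then have "finite (h i)" using h by auto
    then have "F i -` {h i} \<inter> space M \<in> sets M"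
      using i by (intro measurable_sets[OF F_measurable]) auto
    also have "F i -` {h i} \<inter> space M = {\<omega> \<in> space M. F i \<omega> = h i}" by auto
    finally show "{\<omega> \<in> space M. F i \<omega> = h i} \<in> sets M" .
  qed simp
  also have "{\<omega> \<in> space M. \<forall>i\<in>{1..n}. F i \<omega> = h i} = hist n -` {h} \<inter> space M"
    using hist_eq_iff[OF h] by auto
  finally show "hist n -` {h} \<inter> space M \<in> sets M" .
qed

lemma hist_sets [measurable]: "{\<omega> \<in> space M. Q (hist n \<omega>)} \<in> sets M"
proof -
  have "hist n -` ({h. Q h} \<inter> histories n) \<inter> space M \<in> sets M"
    by (intro measurable_sets[OF hist_measurable]) simp
  also have "hist n -` ({h. Q h} \<inter> histories n) \<inter> space M = {\<omega> \<in> space M. Q (hist n \<omega>)}"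
    using measurable_space[OF hist_measurable] by auto
  finally show ?thesis .
qed

lemma y_sets [measurable]: "n \<ge> 1 \<Longrightarrow> {\<omega> \<in> space M. y n \<omega> = z} \<in> sets M"
proof -
  assume "n \<ge> 1"
  then have "y n -` {z} \<inter> space M \<in> sets M" by (intro measurable_sets[OF y_measurable]) auto
  also have "y n -` {z} \<inter> space M = {\<omega> \<in> space M. y n \<omega> = z}" by auto
  finally show ?thesis .
qed

lemma hist_y_sets:
  assumes "n \<ge> 1"
  shows "{\<omega> \<in> space M. Q (hist n \<omega>) \<and> y (n + 1) \<omega> = z} \<in> sets M"
  using sets.Int[OF hist_sets[of Q n] y_sets[of "n + 1" z]]
  by (simp add: Collect_conj_eq Int_assoc Int_left_commute Int_commute Int_left_absorb)

text \<open>Sums the elementary conditional probabilities over the countably many histories.\<close>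

lemma prob_hist_next_le:
  assumes n: "n \<ge> 1" and q: "q \<ge> 0"
    and bound: "AE \<omega> in M. Q (hist n \<omega>) \<longrightarrow> m (outer_boundary (F n \<omega>)) z \<le> q"
  shows "prob {\<omega> \<in> space M. Q (hist n \<omega>) \<and> y (n + 1) \<omega> = z} \<le> q * prob {\<omega> \<in> space M. Q (hist n \<omega>)}"
proof -
  define I where "I = {h \<in> histories n. Q h}"
  define X where "X h = {\<omega> \<in> space M. hist n \<omega> = h \<and> y (n + 1) \<omega> = z}" for h
  define Y where "Y h = {\<omega> \<in> space M. hist n \<omega> = h}" for h
  have I: "countable I" unfolding I_def using countable_histories by (rule countable_subset[rotated]) auto
  have Xs: "X h \<in> sets M" for h unfolding X_def by (rule hist_y_sets[OF n])
  have Ys: "Y h \<in> sets M" for h unfolding Y_def by (rule hist_sets)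
  have in_I: "hist n \<omega> \<in> I \<longleftrightarrow> Q (hist n \<omega>)" if "\<omega> \<in> space M" for \<omega>
    using measurable_space[OF hist_measurable that, of n] by (simp add: I_def)
  have XY: "prob (X h) \<le> q * prob (Y h)" if h: "h \<in> I" for h
  proof (cases "prob (Y h) > 0")
    case True
    have Yh: "Y h = {\<omega> \<in> space M. \<forall>i\<in>{1..n}. F i \<omega> = h i}"
      using h hist_eq_iff by (auto simp: Y_def I_def)
    have Xh: "X h = {\<omega> \<in> space M. y (n + 1) \<omega> = z \<and> (\<forall>i\<in>{1..n}. F i \<omega> = h i)}"
      using h hist_eq_iff by (auto simp: X_def I_def)
    have "prob (X h) / prob (Y h) = m (outer_boundary (h n)) z"
      using conditional_law[OF n, of h z] True unfolding cond_prob_def Yh Xh by simp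
    also have "\<dots> \<le> q"
    proof -
      \<comment> \<open>The boundary mass is constant on \<open>Y h\<close>, and an event of
        positive probability cannot avoid an almost sure one, so the almost sure bound holds for
        \<open>h\<close> itself.\<close>
      have "\<not> (AE \<omega> in M. \<omega> \<notin> Y h)"
        using True Ys[of h] by (simp add: prob_eq_0[symmetric])
      moreover have "AE \<omega> in M. \<omega> \<notin> Y h" if "\<not> m (outer_boundary (h n)) z \<le> q"
        using bound
      proof eventually_elim
        case (elim \<omega>)
        have "F n \<omega> = h n" if "\<omega> \<in> Y h" using that n unfolding Yh by auto
        then show ?case using elim that h by (auto simp: Y_def I_def)
      qed
      ultimately show ?thesis by blast
    qed
    finally show ?thesis using True by (simp add: pos_divide_le_eq)
  next
    case False
    have "prob (X h) \<le> prob (Y h)" using Ys by (intro finite_measure_mono) (auto simp: X_def Y_def)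
    moreover have "prob (Y h) = 0" using False measure_nonneg[of M "Y h"] by simp
    ultimately show ?thesis by simp
  qed
  have "emeasure M {\<omega> \<in> space M. Q (hist n \<omega>) \<and> y (n + 1) \<omega> = z} = emeasure M (\<Union>h\<in>I. X h)"
    using in_I by (intro arg_cong[of _ _ "emeasure M"]) (auto simp: X_def)
  also have "\<dots> = (\<integral>\<^sup>+h. emeasure M (X h) \<partial>count_space I)"
    using I Xs by (intro emeasure_UN_countable) (auto simp: disjoint_family_on_def X_def)
  also have "\<dots> \<le> (\<integral>\<^sup>+h. ennreal q * emeasure M (Y h) \<partial>count_space I)"
    using XY q by (intro nn_integral_mono) (simp add: emeasure_eq_measure ennreal_mult[symmetric] ennreal_leI)
  also have "\<dots> = ennreal q * (\<integral>\<^sup>+h. emeasure M (Y h) \<partial>count_space I)"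
    by (rule nn_integral_cmult) simp
  also have "(\<integral>\<^sup>+h. emeasure M (Y h) \<partial>count_space I) = emeasure M (\<Union>h\<in>I. Y h)"
    using I Ys by (intro emeasure_UN_countable[symmetric]) (auto simp: disjoint_family_on_def Y_def)
  also have "(\<Union>h\<in>I. Y h) = {\<omega> \<in> space M. Q (hist n \<omega>)}"
    using in_I by (auto simp: Y_def)
  finally show ?thesis
    using q by (simp add: emeasure_eq_measure ennreal_mult[symmetric])
qed

lemma hist_at: "n \<ge> 1 \<Longrightarrow> hist n \<omega> n = F n \<omega>"
  by (simp add: hist_def)

text \<open>The case \<open>q = 0\<close> of the preceding bound, for each of the countably many
  times and lattice points.\<close>

lemma AE_y_in_boundary: "AE \<omega> in M. \<forall>n\<ge>1. y (n + 1) \<omega> \<in> outer_boundary (F n \<omega>)"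
proof -
  have "AE \<omega> in M. y (n + 1) \<omega> \<in> outer_boundary (F n \<omega>)" if n: "n \<ge> 1" for n
  proof -
    have "AE \<omega> in M. \<not> (z \<notin> outer_boundary (F n \<omega>) \<and> y (n + 1) \<omega> = z)" for z
    proof -
      let ?E = "{\<omega> \<in> space M. z \<notin> outer_boundary (hist n \<omega> n) \<and> y (n + 1) \<omega> = z}"
      have "prob ?E \<le> 0 * prob {\<omega> \<in> space M. z \<notin> outer_boundary (hist n \<omega> n)}"
        by (rule prob_hist_next_le[OF n]) (auto simp: hist_at[OF n] concentrated)
      then have "prob ?E = 0" by (simp add: measure_le_0_iff)
      then have "AE \<omega> in M. \<omega> \<notin> ?E"
        using prob_eq_0[OF hist_y_sets[OF n, of "\<lambda>h. z \<notin> outer_boundary (h n)" z]] by simp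
      then show ?thesis by (rule AE_mp) (auto simp: hist_at[OF n])
    qed
    then have "AE \<omega> in M. \<forall>z. \<not> (z \<notin> outer_boundary (F n \<omega>) \<and> y (n + 1) \<omega> = z)"
      unfolding AE_all_countable by blast
    then show ?thesis by (rule AE_mp) auto
  qed
  then show ?thesis by (simp add: AE_all_countable)
qed

lemma AE_growing: "AE \<omega> in M. \<forall>n\<ge>1. \<exists>z\<in>outer_boundary (F n \<omega>). F (n + 1) \<omega> = insert z (F n \<omega>)"
  using AE_y_in_boundary AE_space by eventually_elim (use F_step in blast)

lemma AE_cluster_card: "AE \<omega> in M. \<forall>n\<ge>1. cluster (F n \<omega>) \<and> card (F n \<omega>) = n"
  using AE_growing
proof (rule AE_mp, intro AE_I2 impI allI)
  fix \<omega> and n :: nat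
  assume \<omega>: "\<omega> \<in> space M"
    and g: "\<forall>n\<ge>1. \<exists>z\<in>outer_boundary (F n \<omega>). F (n + 1) \<omega> = insert z (F n \<omega>)" and n: "n \<ge> 1"
  show "cluster (F n \<omega>) \<and> card (F n \<omega>) = n"
    using n
  proof (induction n rule: nat_induct_at_least)
    case base
    then show ?case using F_1[OF \<omega>] cluster.origin by simp
  next
    case (Suc n)
    obtain z where z: "z \<in> outer_boundary (F n \<omega>)" "F (Suc n) \<omega> = insert z (F n \<omega>)"
      using g Suc.hyps by auto
    then have "z \<notin> F n \<omega>" by (simp add: outer_boundary_def)
    then show ?case
      using z Suc.IH finite_F[OF Suc.hyps \<omega>] cluster.attach[of "F n \<omega>" z] by simp
  qed
qed

lemma F_mono: "n \<ge> 1 \<Longrightarrow> \<omega> \<in> space M \<Longrightarrow> F n \<omega> \<subseteq> F (n + 1) \<omega>"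
  using F_step by blast

section \<open>Probability of long chains\<close>

definition reach_event :: "real \<Rightarrow> nat \<Rightarrow> nat \<Rightarrow> lattice \<Rightarrow> 'w set" where
  "reach_event s k n z = {\<omega> \<in> space M. reach (hist n \<omega>) s k n z}"

lemma reach_hist: "reach (hist n \<omega>) s k n z \<longleftrightarrow> reach (\<lambda>i. F i \<omega>) s k n z"
  by (rule reach_cong) (simp add: hist_def)

lemma reach_event_sets [measurable]: "reach_event s k n z \<in> sets M"
  unfolding reach_event_def by (rule hist_sets)

text \<open>Conditioning on the time of the last attachment turns the union bound over all chains
  and all attachment times into Pascal's rule.\<close>

lemma prob_reach_le:
  assumes q: "q \<ge> 0"
    and bound: "\<And>A x z. cluster A \<Longrightarrow> x \<in> A \<Longrightarrow> s \<le> norm (point x) \<Longrightarrow> m (outer_boundary A) z \<le> q"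
  shows "prob (reach_event s k n z) \<le> real (n choose k) * (4 * q) ^ k"
proof (induction n arbitrary: k z)
  case 0
  then show ?case by (cases k) (auto simp: reach_event_def)
next
  case (Suc n)
  show ?case
  proof (cases k)
    case 0
    then show ?thesis by simp
  next
    case k: (Suc j)
    show ?thesis
    proof (cases "n \<ge> 1")
      case False
      then have "n = 0" by simp
      then show ?thesis using q by (simp add: k reach_event_def)
    next
      case n: True
      let ?N = "\<lambda>u. {\<omega> \<in> space M. reach (hist n \<omega>) s j n u \<and> y (n + 1) \<omega> = z}"
      have N: "prob (?N u) \<le> q * (real (n choose j) * (4 * q) ^ j)" for u
      proof -
        have "prob (?N u) \<le> q * prob {\<omega> \<in> space M. reach (hist n \<omega>) s j n u}"
        proof (rule prob_hist_next_le[OF n q])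
          show "AE \<omega> in M. reach (hist n \<omega>) s j n u \<longrightarrow> m (outer_boundary (F n \<omega>)) z \<le> q"
            using AE_cluster_card
          proof (rule AE_mp, intro AE_I2 impI)
            fix \<omega> assume \<omega>: "\<omega> \<in> space M" and c: "\<forall>n\<ge>1. cluster (F n \<omega>) \<and> card (F n \<omega>) = n"
              and r: "reach (hist n \<omega>) s j n u"
            then obtain x where "x \<in> F n \<omega>" "s \<le> norm (point x)"
              using reach_imp_far[of "\<lambda>i. F i \<omega>" s j n u] F_mono[OF _ \<omega>] by (auto simp: reach_hist)
            then show "m (outer_boundary (F n \<omega>)) z \<le> q" using bound c n by blast
          qed
        qed
        also have "\<dots> \<le> q * (real (n choose j) * (4 * q) ^ j)"
          using Suc.IH[of j u] q unfolding reach_event_def by (intro mult_left_mono) auto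
        finally show ?thesis .
      qed
      \<comment> \<open>Either the chain to \<open>z\<close> was complete before, or
        \<open>z\<close> is attached now and extends a chain that ended at a neighbour
        \<open>u\<close>.\<close>
      have "reach_event s k (Suc n) z \<subseteq> reach_event s k n z \<union> (\<Union>u\<in>nbhd z. ?N u)"
      proof
        fix \<omega> assume "\<omega> \<in> reach_event s k (Suc n) z"
        then have \<omega>: "\<omega> \<in> space M" and r: "reach (\<lambda>i. F i \<omega>) s (Suc j) (Suc n) z"
          by (simp_all only: reach_event_def reach_hist k mem_Collect_eq)
        show "\<omega> \<in> reach_event s k n z \<union> (\<Union>u\<in>nbhd z. ?N u)"
        proof (cases "reach (\<lambda>i. F i \<omega>) s (Suc j) n z")
          case True
          then show ?thesis using \<omega> by (simp add: reach_event_def reach_hist k)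
        next
          case False
          then obtain u where u: "u \<in> nbhd z" "reach (\<lambda>i. F i \<omega>) s j n u" "z \<in> F (n + 1) \<omega> - F n \<omega>"
            using r by auto
          then have "y (n + 1) \<omega> = z" using F_step[OF n \<omega>] by auto
          then show ?thesis using u \<omega> by (auto simp: reach_hist)
        qed
      qed
      then have "prob (reach_event s k (Suc n) z) \<le> prob (reach_event s k n z \<union> (\<Union>u\<in>nbhd z. ?N u))"
        using hist_y_sets[OF n] finite_nbhd by (intro finite_measure_mono) auto
      also have "\<dots> \<le> prob (reach_event s k n z) + prob (\<Union>u\<in>nbhd z. ?N u)"
        using hist_y_sets[OF n] finite_nbhd by (intro measure_Un_le) auto
      also have "prob (\<Union>u\<in>nbhd z. ?N u) \<le> (\<Sum>u\<in>nbhd z. prob (?N u))"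
        using hist_y_sets[OF n] finite_nbhd by (intro measure_UNION_le) auto
      also have "\<dots> \<le> real (card (nbhd z)) * (q * (real (n choose j) * (4 * q) ^ j))"
        by (rule sum_bounded_above) (rule N)
      also have "\<dots> \<le> 4 * (q * (real (n choose j) * (4 * q) ^ j))"
        using card_nbhd_le[of z] q by (intro mult_right_mono) auto
      also have "prob (reach_event s k n z) \<le> real (n choose k) * (4 * q) ^ k" by (rule Suc.IH)
      \<comment> \<open>The new link costs a factor 4 q: at most 4 choices of \<open>u\<close>, and
        at most \<open>q\<close> for attaching \<open>z\<close> given the past.\<close>
      finally show ?thesis by (simp add: k algebra_simps)
    qed
  qed
qed

text \<open>Union bound over the end of the chain. Each attachment raises the largest norm by at
  most 1, so at time \<open>N\<close> this end lies in a box of side 2 N + 1; only a polynomial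
  factor is lost.\<close>

lemma prob_far_le:
  fixes N :: nat
  assumes q: "q \<ge> 0" and s: "s > 0" and N: "N \<ge> 1"
    and bound: "\<And>A x z. cluster A \<Longrightarrow> x \<in> A \<Longrightarrow> s \<le> norm (point x) \<Longrightarrow> m (outer_boundary A) z \<le> q"
  shows "prob {\<omega> \<in> space M. \<exists>z\<in>hist N \<omega> N. s + real k \<le> norm (point z)} \<le>
    real ((2 * N + 1)\<^sup>2) * (real (N choose k) * (4 * q) ^ k)"
proof -
  let ?E = "{\<omega> \<in> space M. \<exists>z\<in>hist N \<omega> N. s + real k \<le> norm (point z)}"
  let ?U = "\<Union>z\<in>box_around_0 N. reach_event s k N z"
  have "AE \<omega> in M. \<omega> \<in> ?E \<longrightarrow> \<omega> \<in> ?U"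
    using AE_growing
  proof (rule AE_mp, intro AE_I2 impI)
    fix \<omega> assume \<omega>: "\<omega> \<in> space M"
      and g: "\<forall>n\<ge>1. \<exists>z\<in>outer_boundary (F n \<omega>). F (n + 1) \<omega> = insert z (F n \<omega>)"
      and "\<omega> \<in> ?E"
    then obtain z where z: "z \<in> F N \<omega>" "s + real k \<le> norm (point z)"
      using hist_at[OF N] by auto
    have "reach (\<lambda>i. F i \<omega>) s k N z"
      using reach_if_growing[of N "\<lambda>i. F i \<omega>" z s k] F_1[OF \<omega>] g N s z by simp
    moreover have "\<forall>z\<in>F n \<omega>. norm (point z) < real n" if "n \<ge> 1" for n
      using that
    proof (induction n rule: nat_induct_at_least)
      case base
      then show ?case using F_1[OF \<omega>] by (simp add: point_0)
    next
      case (Suc n)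
      obtain w where w: "w \<in> outer_boundary (F n \<omega>)" "F (Suc n) \<omega> = insert w (F n \<omega>)"
        using g Suc.hyps by auto
      then obtain u where u: "u \<in> F n \<omega>" "neighbours u w"
        using neighbours_sym by (auto simp: outer_boundary_def)
      have "norm (point w) < real (Suc n)"
        using norm_point_neighbours[OF u(2)] Suc.IH u(1) by fastforce
      then show ?case using w(2) Suc.IH by fastforce
    qed
    then have "z \<in> box_around_0 N"
      using z(1) N by (intro norm_point_le_imp_in_box) fastforce
    ultimately show "\<omega> \<in> ?U" using \<omega> by (auto simp: reach_event_def reach_hist)
  qed
  then have "prob ?E \<le> prob ?U"
    using finite_box_around_0 by (intro finite_measure_mono_AE) auto
  also have "\<dots> \<le> (\<Sum>z\<in>box_around_0 N. prob (reach_event s k N z))"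
    using finite_box_around_0 by (intro measure_UNION_le) auto
  also have "\<dots> \<le> real (card (box_around_0 N)) * (real (N choose k) * (4 * q) ^ k)"
    by (rule sum_bounded_above) (rule prob_reach_le[OF q bound])
  also have "\<dots> \<le> real ((2 * N + 1)\<^sup>2) * (real (N choose k) * (4 * q) ^ k)"
    using card_box_around_0_le[of N] q by (intro mult_right_mono of_nat_mono) auto
  finally show ?thesis .
qed

lemma AE_eventually_near:
  assumes bound: "\<And>A x z K. cluster A \<Longrightarrow> x \<in> A \<Longrightarrow> 8 * real K \<le> norm (point x) \<Longrightarrow> K > 0 \<Longrightarrow>
    m (outer_boundary A) z \<le> 2 / real K"
  shows "AE \<omega> in M. eventually (\<lambda>K. \<forall>z\<in>F (K\<^sup>2 div 6) \<omega>. norm (point z) < 16 * real K) sequentially"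
proof -
  define N where "N K = K\<^sup>2 div 6" for K :: nat
  define E where "E K = {\<omega> \<in> space M. \<exists>z\<in>hist (N K) \<omega> (N K). 8 * real K + real (8 * K) \<le> norm (point z)}" for K
  \<comment> \<open>Times start at 1, and 3 is the first \<open>K\<close> with
    \<open>K\<^sup>2 div 6\<close> positive.\<close>
  have N1: "N K \<ge> 1" if "K \<ge> 3" for K
  proof -
    have "3\<^sup>2 \<le> K\<^sup>2" using that by (rule power_mono) simp
    then show ?thesis by (simp add: N_def)
  qed
  have NK: "6 * real (N K) \<le> (real K)\<^sup>2" for K
  proof -
    have "6 * N K \<le> K\<^sup>2" by (simp add: N_def)
    then show ?thesis by (metis of_nat_le_iff of_nat_mult of_nat_numeral of_nat_power)
  qed
  have prob_le: "prob (E K) \<le> (2 * (real K)\<^sup>2 + 1)\<^sup>2 * (1/2) ^ K" if K: "K \<ge> 3" for K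
  proof -
    have "prob (E K) \<le> real ((2 * N K + 1)\<^sup>2) * (real (N K choose (8 * K)) * (4 * (2 / real K)) ^ (8 * K))"
      unfolding E_def using K N1[OF K] bound[of _ _ K] by (intro prob_far_le) auto
    also have "real (N K choose (8 * K)) * (4 * (2 / real K)) ^ (8 * K) \<le>
        (exp 1 * real (N K) * (4 * (2 / real K)) / real (8 * K)) ^ (8 * K)"
      using K by (intro binomial_mult_power_le) auto
    \<comment> \<open>Four neighbours times mass 2 / K give 8 / K, whose 8 cancels against the chain
      length 8 K.\<close>
    also have "exp 1 * real (N K) * (4 * (2 / real K)) / real (8 * K) = exp 1 * real (N K) / (real K)\<^sup>2"
      using K by (simp add: field_simps power2_eq_square)
    also have "(exp 1 * real (N K) / (real K)\<^sup>2) ^ (8 * K) \<le> (1/2) ^ (8 * K)"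
    proof (rule power_mono)
      have "exp 1 * real (N K) \<le> 3 * real (N K)" using exp_le by (intro mult_right_mono) auto
      also have "\<dots> \<le> 1/2 * (real K)\<^sup>2" using NK[of K] by simp
      finally show "exp 1 * real (N K) / (real K)\<^sup>2 \<le> 1/2" using K by (simp add: field_simps)
    qed simp
    also have "(1/2 :: real) ^ (8 * K) \<le> (1/2) ^ K" by (rule power_decreasing) auto
    also have "real ((2 * N K + 1)\<^sup>2) \<le> (2 * (real K)\<^sup>2 + 1)\<^sup>2"
      unfolding of_nat_power
    proof (rule power_mono)
      have "real (2 * N K + 1) = 2 * real (N K) + 1" by simp
      then show "real (2 * N K + 1) \<le> 2 * (real K)\<^sup>2 + 1" using NK[of K] by linarith
    qed simp
    finally show ?thesis by (simp add: mult_left_mono mult_right_mono)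
  qed
  have "summable (\<lambda>K. prob (E K))"
  proof (rule summable_comparison_test_ev)
    show "eventually (\<lambda>K. norm (prob (E K)) \<le> (2 * (real K)\<^sup>2 + 1)\<^sup>2 * (1/2) ^ K) sequentially"
      using eventually_ge_at_top[of 3] by eventually_elim (use prob_le in simp)
    \<comment> \<open>Raising the ratio from 1/2 to 3/4 absorbs the polynomial factor.\<close>
    show "summable (\<lambda>K. (2 * (real K)\<^sup>2 + 1)\<^sup>2 * (1/2) ^ K)"
    proof (rule summable_comparison_test_bigo)
      show "summable (\<lambda>K. norm ((3/4 :: real) ^ K))" by (simp add: summable_geometric)
      show "(\<lambda>K. (2 * (real K)\<^sup>2 + 1)\<^sup>2 * (1/2) ^ K) \<in> O(\<lambda>K. (3/4 :: real) ^ K)" by real_asymp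
    qed
  qed
  then have "AE \<omega> in M. eventually (\<lambda>K. \<omega> \<in> space M - E K) sequentially"
    unfolding E_def by (intro borel_cantelli_AE1 hist_sets) (simp_all add: emeasure_eq_measure)
  then show ?thesis
  proof (rule AE_mp, intro AE_I2 impI)
    fix \<omega> assume \<omega>: "\<omega> \<in> space M" and e: "eventually (\<lambda>K. \<omega> \<in> space M - E K) sequentially"
    show "eventually (\<lambda>K. \<forall>z\<in>F (K\<^sup>2 div 6) \<omega>. norm (point z) < 16 * real K) sequentially"
      using e eventually_ge_at_top[of 3]
    proof eventually_elim
      case (elim K)
      then show ?case using hist_at[OF N1[of K], of \<omega>] \<omega>
        by (auto simp: E_def N_def not_le)
    qed
  qed
qed

end

section \<open>The fractal dimension of ballistic aggregation\<close>

theorem corollary5p3: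
  fixes \<mu> :: "(real ^ 2) set measure"
    and v :: "(real ^ 2) set \<Rightarrow> real ^ 2"
    and M :: "'w measure"
    and F :: "nat \<Rightarrow> 'w \<Rightarrow> lattice set"
  assumes "invariant_line_measure \<mu>"
    and "direction_choice v"
    and "ballistic_aggregation \<mu> v M F"
  shows "AE \<omega> in M. has_fractal_dim (\<lambda>n. F n \<omega>) 2 \<and>
           (\<lambda>n. ln (real (card (F n \<omega>))) / ln (rad (F n \<omega>))) \<longlonglongrightarrow> 2"
proof -
  interpret invariant_lines \<mu> by unfold_locales (rule assms(1))
  have agg: "incremental_aggregation M (ballistic_measure \<mu> v) F"
    using assms(3) by (simp add: ballistic_aggregation_def)
  then obtain y where y:
      "\<forall>n\<ge>1. y n \<in> M \<rightarrow>\<^sub>M count_space UNIV"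
      "\<forall>\<omega>\<in>space M. y 1 \<omega> = 0 \<and> F 1 \<omega> = {y 1 \<omega>}"
      "\<forall>n\<ge>1. \<forall>\<omega>\<in>space M. F (n + 1) \<omega> = F n \<omega> \<union> {y (n + 1) \<omega>}"
      "\<forall>n\<ge>1. \<forall>(A :: nat \<Rightarrow> lattice set) z.
             \<P>(\<omega> in M. \<forall>i\<in>{1..n}. F i \<omega> = A i) > 0 \<longrightarrow>
             \<P>(\<omega> in M. y (n + 1) \<omega> = z \<bar> \<forall>i\<in>{1..n}. F i \<omega> = A i) =
               ballistic_measure \<mu> v (outer_boundary (A n)) z"
    unfolding incremental_aggregation_def by auto
  interpret prob_space M using agg by (simp add: incremental_aggregation_def)
  interpret aggregation M "ballistic_measure \<mu> v" F y
  proof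
    show "F (n + 1) \<omega> = insert (y (n + 1) \<omega>) (F n \<omega>)" if "n \<ge> 1" "\<omega> \<in> space M" for n \<omega>
      using y(3) that by simp
    show "F 1 \<omega> = {0}" if "\<omega> \<in> space M" for \<omega>
      using y(2) that by simp
  qed (use y(1,4) in \<open>simp_all add: ballistic_measure_eq_0\<close>)
  have "AE \<omega> in M. eventually (\<lambda>K. \<forall>z\<in>F (K\<^sup>2 div 6) \<omega>. norm (point z) < 16 * real K) sequentially"
    using ballistic_measure_boundary_le by (rule AE_eventually_near)
  with AE_cluster_card show ?thesis
  proof (rule AE_mp[OF AE_conjI], intro AE_I2 impI, elim conjE)
    fix \<omega> assume \<omega>: "\<omega> \<in> space M"
      and c: "\<forall>n\<ge>1. cluster (F n \<omega>) \<and> card (F n \<omega>) = n"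
      and e: "eventually (\<lambda>K. \<forall>z\<in>F (K\<^sup>2 div 6) \<omega>. norm (point z) < 16 * real K) sequentially"
    have lim: "(\<lambda>n. ln (real (card (F n \<omega>))) / ln (rad (F n \<omega>))) \<longlonglongrightarrow> 2"
      using c F_mono[OF _ \<omega>] e by (intro fractal_dim_eq_2) auto
    then show "has_fractal_dim (\<lambda>n. F n \<omega>) 2 \<and>
        (\<lambda>n. ln (real (card (F n \<omega>))) / ln (rad (F n \<omega>))) \<longlonglongrightarrow> 2"
      using has_fractal_dimI[OF lim] by simp
  qed
qed

end
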